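(* Let $k,l$ be positive integers with $\gcd(k,l)=1$, and for each positive integer $n$ with $n\nmid k$ and $n\nmid l$ let $\tau(n)=\tau_{k,l}(n)$ be the number of spanning trees of the $I$-graph $I(n,k,l)$. Then there exists an integer sequence $a(n)=a_{k,l}(n)$, $n\in\mathbb{N}$, such that for all such $n$: 1. $\tau(n)=n\,a(n)^2$ when $n$ is odd; 2. $\tau(n)=6n\,a(n)^2$ when $n$ is even and $k+l$ is even; 3. $\tau(n)=n\,a(n)^2$ when $n$ is even and $k+l$ is odd.
   Context: The $I$-graph $I(n,k,l)$ is the multigraph with vertex set $\{u_i,v_i : i\in\mathbb{Z}/n\}$ and with edges $u_iu_{i+l}$, $u_iv_i$, $v_iv_{i+k}$, one of each kind for every $i\in\mathbb{Z}/n$ (subscripts modulo $n$; $3n$ edges in total). Multiple edges are allowed (parallel edges are distinguished when counting spanning trees), and the graph is $3$-valent; the conditions $n\nmid k$, $n\nmid l$ say there are no loops. *)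

theory Defs
  imports Main "Graph_Theory.Digraph_Component"
begin

section \<open>Spanning trees of undirected multigraphs\<close>

text \<open>
  An undirected multigraph is represented by a \<^typ>\<open>('a, 'b) pre_digraph\<close> with one labelled
  arc per edge; the orientation of the arc is arbitrary and is ignored below.

  The library notions \<^const>\<open>spanning\<close> and \<^const>\<open>connected\<close> (connectedness of the symmetrised
  graph) are already insensitive to the orientation and are used as they are. The
  library notions \<^const>\<open>forest\<close> and \<^const>\<open>spanning_tree\<close> are not suitable, because
  they only exclude directed cycles; acyclicity is therefore redefined here.
\<close>

definition joins :: "('a, 'b) pre_digraph \<Rightarrow> 'b \<Rightarrow> 'a \<Rightarrow> 'a \<Rightarrow> bool" where
  "joins G e x y \<longleftrightarrow>
     e \<in> arcs G \<and> (tail G e = x \<and> head G e = y \<or> tail G e = y \<and> head G e = x)"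

text \<open>
  The cycle runs through \<open>xs ! 0\<close>, \<open>es ! 0\<close>, \<open>xs ! 1\<close>, \<open>es ! 1\<close>, \dots and back to \<open>xs ! 0\<close>.
  Length 1 is a loop, and length 2 is a pair of distinct parallel edges.
\<close>

definition undirected_cycle :: "('a, 'b) pre_digraph \<Rightarrow> 'a list \<Rightarrow> 'b list \<Rightarrow> bool" where
  "undirected_cycle G xs es \<longleftrightarrow>
     es \<noteq> [] \<and> length xs = length es \<and> distinct xs \<and> distinct es \<and>
     (\<forall>i < length es. joins G (es ! i) (xs ! i) (xs ! (Suc i mod length es)))"

definition undirected_tree :: "('a, 'b) pre_digraph \<Rightarrow> bool" where
  "undirected_tree G \<longleftrightarrow> connected G \<and> \<not> (\<exists>xs es. undirected_cycle G xs es)"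

definition num_spanning_trees :: "('a, 'b) pre_digraph \<Rightarrow> nat" where
  "num_spanning_trees G = card {T. spanning T G \<and> undirected_tree T}"


section \<open>I-graphs\<close>

text \<open>The residue classes modulo \<open>n\<close> are represented by \<open>0, \<dots>, n - 1\<close>.\<close>

datatype I_vertex = Uvert nat | Vvert nat

datatype I_edge = Uedge nat | Spoke nat | Vedge nat

definition I_graph :: "nat \<Rightarrow> nat \<Rightarrow> nat \<Rightarrow> (I_vertex, I_edge) pre_digraph" where
  "I_graph n k l = \<lparr>
     verts = Uvert ` {..<n} \<union> Vvert ` {..<n},
     arcs = Uedge ` {..<n} \<union> Spoke ` {..<n} \<union> Vedge ` {..<n},
     tail = (\<lambda>e. case e of Uedge i \<Rightarrow> Uvert i
                         | Spoke i \<Rightarrow> Uvert i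
                         | Vedge i \<Rightarrow> Vvert i),
     head = (\<lambda>e. case e of Uedge i \<Rightarrow> Uvert ((i + l) mod n)
                         | Spoke i \<Rightarrow> Vvert i
                         | Vedge i \<Rightarrow> Vvert ((i + k) mod n)) \<rparr>"

lemma fin_digraph_I_graph: "fin_digraph (I_graph n k l)"
  by unfold_locales (auto simp: I_graph_def)

lemma card_arcs_I_graph: "card (arcs (I_graph n k l)) = 3 * n"
proof -
  have "card (arcs (I_graph n k l)) =
      card (Uedge ` {..<n}) + card (Spoke ` {..<n}) + card (Vedge ` {..<n})"
    unfolding I_graph_def by (simp, subst card_Un_disjoint; (subst card_Un_disjoint)?; auto)
  then show ?thesis by (simp add: card_image inj_on_def)
qed

lemma loopfree_I_graph:
  assumes "\<not> n dvd k" "\<not> n dvd l"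
  shows "loopfree_digraph (I_graph n k l)"
proof -
  interpret fin_digraph "I_graph n k l" by (rule fin_digraph_I_graph)
  have shift: "(i + d) mod n \<noteq> i" if "i < n" "\<not> n dvd d" for i d
  proof
    assume "(i + d) mod n = i"
    then have "(i + d) mod n = i mod n" using that by simp
    then have "n dvd (i + d) - i" using mod_eq_dvd_iff_nat[of i "i + d" n] by simp
    then show False using that by simp
  qed
  show ?thesis
    by unfold_locales (use assms in \<open>auto simp: I_graph_def dest: shift\<close>)
qed

end

theory Submission
  imports Defs "Jordan_Normal_Form.Char_Poly"
begin

text \<open>
  The matrix-tree theorem and a Fourier transform over the residues modulo \<open>n\<close> give
  \<open>n * \<tau>(n) = (\<Prod>j = 1..<n. P \<theta>\<^sub>j)\<close> with \<open>\<theta>\<^sub>j = 2 \<pi> j / n\<close> and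
  \<open>P \<theta> = (3 - 2 cos (l \<theta>)) * (3 - 2 cos (k \<theta>)) - 1\<close>.
  For each \<open>m\<close> there is an integer polynomial \<open>F m\<close> with
  \<open>2 - 2 cos (m \<theta>) = (2 - 2 cos \<theta>) * F m (2 cos \<theta>)\<close>. Writing
  \<open>3 - 2 cos (m \<theta>) = 1 + (2 - 2 cos \<theta>) * F m (2 cos \<theta>)\<close> and expanding shows
  \<open>P \<theta> = (2 - 2 cos \<theta>) * S (2 cos \<theta>)\<close> with
  \<open>S t = F l t + F k t + (2 - t) * F l t * F k t\<close>. Since the numbers \<open>2 - 2 cos \<theta>\<^sub>j\<close> multiply to
  \<open>n\<^sup>2\<close>, it follows that \<open>\<tau>(n) = n * (\<Prod>j = 1..<n. S (2 cos \<theta>\<^sub>j))\<close>, which has the factor \<open>n\<close> of the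
  theorem in front.

  The factors for \<open>j\<close> and \<open>n - j\<close> coincide. Hence the product is the square of
  \<open>a = (\<Prod>0 < j < n/2. S (2 cos \<theta>\<^sub>j))\<close>, times the unpaired factor \<open>S (-2)\<close> when \<open>n\<close> is even; and
  \<open>F m (-2)\<close> is the parity of \<open>m\<close>, so that \<open>S (-2)\<close> is \<open>6\<close> if \<open>k\<close> and \<open>l\<close> are odd and \<open>1\<close> if
  exactly one of them is. Finally \<open>a\<close> is an integer because the numbers \<open>2 cos \<theta>\<^sub>j\<close> with
  \<open>0 < j < n/2\<close> are precisely the roots of a monic integer polynomial.

  Three parts carry the proof.

  \<^item> The matrix-tree theorem (\<open>matrix_tree\<close>) for multigraphs. Each row of the Laplacian is a sum over
    the edges at a vertex. Multilinearity of the determinant in the rows turns the reduced Laplacian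
    into a sum over all ways to choose an incident edge at every vertex other than the root. Such a
    choice contributes 1 if following the chosen edges always leads to the root, and 0 otherwise; the
    choices that contribute correspond bijectively to the spanning trees
    (\<open>num_spanning_trees_eq_card_rooted_choices\<close>). A rank-one update of the full Laplacian
    (\<open>matrix_tree_rank_one_update\<close>) gives the same number, up to a square factor, without singling
    out a root, which keeps the rotational symmetry needed for the Fourier transform.

  \<^item> Determinants from eigenvectors (\<open>det_eq_prod_eigenvalues\<close>) with Vandermonde matrices as
    eigenbases. For the nodes \<open>exp (\<i> \<theta>\<^sub>j)\<close> this diagonalises the circulant matrices that the Laplacian of
    an I-graph consists of. For the roots of a monic integer polynomial \<open>f\<close> it diagonalises
    multiplication by \<open>p\<close> modulo \<open>f\<close>, an integer matrix, so the product of the values of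
    \<open>p\<close> at these roots is an integer (\<open>prod_poly_at_roots_in_Ints\<close>).

  \<^item> Chebyshev-type recurrences for the polynomials \<open>F m\<close> (\<open>chord_poly\<close>) and for the monic polynomial with
    the roots \<open>2 cos \<theta>\<^sub>j\<close> (built from \<open>sine_poly\<close>).
\<close>

section \<open>Spanning trees as choices of parent edges\<close>

definition incident :: "('a, 'b) pre_digraph \<Rightarrow> 'a \<Rightarrow> 'b set" where
  "incident G v = {e \<in> arcs G. tail G e = v \<or> head G e = v}"

text \<open>
  Only meant for edges that are incident with \<open>v\<close>. At a loop the opposite end is \<open>v\<close> itself, so
  loops will contribute nothing to the Laplacian below.
\<close>

definition opposite :: "('a, 'b) pre_digraph \<Rightarrow> 'b \<Rightarrow> 'a \<Rightarrow> 'a" where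
  "opposite G e v = (if tail G e = v then head G e else tail G e)"

text \<open>
  The root is its own parent, so that iterating \<^term>\<open>parent G r f\<close> stops there.
\<close>

definition parent :: "('a, 'b) pre_digraph \<Rightarrow> 'a \<Rightarrow> ('a \<Rightarrow> 'b) \<Rightarrow> 'a \<Rightarrow> 'a" where
  "parent G r f v = (if v = r then r else opposite G (f v) v)"

definition edge_choices :: "('a, 'b) pre_digraph \<Rightarrow> 'a \<Rightarrow> ('a \<Rightarrow> 'b) set" where
  "edge_choices G r = (\<Pi>\<^sub>E v \<in> verts G - {r}. incident G v)"

definition reaches_root :: "('a, 'b) pre_digraph \<Rightarrow> 'a \<Rightarrow> ('a \<Rightarrow> 'b) \<Rightarrow> 'a \<Rightarrow> bool" where
  "reaches_root G r f v \<longleftrightarrow> (\<exists>m. (parent G r f ^^ m) v = r)"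

definition rooted_choices :: "('a, 'b) pre_digraph \<Rightarrow> 'a \<Rightarrow> ('a \<Rightarrow> 'b) set" where
  "rooted_choices G r = {f \<in> edge_choices G r. \<forall>v \<in> verts G. reaches_root G r f v}"

definition depth :: "('a, 'b) pre_digraph \<Rightarrow> 'a \<Rightarrow> ('a \<Rightarrow> 'b) \<Rightarrow> 'a \<Rightarrow> nat" where
  "depth G r f v = (LEAST m. (parent G r f ^^ m) v = r)"

lemma joins_opposite: "e \<in> incident G v \<Longrightarrow> joins G e v (opposite G e v)"
  by (auto simp: incident_def opposite_def joins_def)

lemma joins_imp_incident: "joins G e x y \<Longrightarrow> e \<in> incident G x"
  by (auto simp: incident_def joins_def)

lemma joins_imp_opposite: "joins G e x y \<Longrightarrow> opposite G e x = y"
  by (auto simp: opposite_def joins_def)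

lemma joins_sym: "joins G e x y \<Longrightarrow> joins G e y x"
  by (auto simp: joins_def)

lemma joins_same_ends:
  "joins G e x y \<Longrightarrow> joins G e x' y' \<Longrightarrow> x = x' \<and> y = y' \<or> x = y' \<and> y = x'"
  by (auto simp: joins_def)

lemma joins_verts: "wf_digraph G \<Longrightarrow> joins G e x y \<Longrightarrow> x \<in> verts G \<and> y \<in> verts G"
  by (auto simp: joins_def wf_digraph_def)

lemma opposite_in_verts: "wf_digraph G \<Longrightarrow> e \<in> incident G v \<Longrightarrow> opposite G e v \<in> verts G"
  using joins_opposite joins_verts by metis

lemma reaches_root_root [simp]: "reaches_root G r f r"
  unfolding reaches_root_def by (rule exI[of _ 0]) simp

lemma parent_root [simp]: "parent G r f r = r"
  by (simp add: parent_def)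

lemma reaches_root_parent: "reaches_root G r f (parent G r f v) \<longleftrightarrow> reaches_root G r f v"
proof
  assume "reaches_root G r f (parent G r f v)"
  then obtain m where "(parent G r f ^^ m) (parent G r f v) = r" by (auto simp: reaches_root_def)
  then have "(parent G r f ^^ Suc m) v = r" by (simp add: funpow_swap1)
  then show "reaches_root G r f v" unfolding reaches_root_def by blast
next
  assume "reaches_root G r f v"
  then obtain m where m: "(parent G r f ^^ m) v = r" by (auto simp: reaches_root_def)
  have "(parent G r f ^^ m) (parent G r f v) = parent G r f ((parent G r f ^^ m) v)"
    by (simp add: funpow_swap1)
  also have "\<dots> = r" by (simp add: m)
  finally show "reaches_root G r f (parent G r f v)" unfolding reaches_root_def by blast
qed

lemma depth_parent:
  assumes "reaches_root G r f v" "v \<noteq> r"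
  shows "depth G r f v = Suc (depth G r f (parent G r f v))"
proof -
  from assms obtain m where m: "(parent G r f ^^ m) v = r" by (auto simp: reaches_root_def)
  have "depth G r f v = Suc (LEAST m. (parent G r f ^^ Suc m) v = r)"
    unfolding depth_def 
    by (rule Least_Suc[where P = "\<lambda>m. (parent G r f ^^ m) v = r", OF m]) (use assms in simp)
  then show ?thesis by (simp add: depth_def funpow_swap1)
qed

lemma parent_neq:
  assumes "reaches_root G r f v" "v \<noteq> r"
  shows "parent G r f v \<noteq> v"
  using depth_parent[OF assms] by auto

lemma rooted_choicesD:
  assumes "f \<in> rooted_choices G r" "v \<in> verts G" "v \<noteq> r"
  shows "f v \<in> incident G v" "joins G (f v) v (parent G r f v)"
    "depth G r f v = Suc (depth G r f (parent G r f v))"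
proof -
  show *: "f v \<in> incident G v"
    using assms by (auto simp: rooted_choices_def edge_choices_def)
  show "joins G (f v) v (parent G r f v)"
    using joins_opposite[OF *] assms(3) by (simp add: parent_def)
  show "depth G r f v = Suc (depth G r f (parent G r f v))"
    using assms by (intro depth_parent) (auto simp: rooted_choices_def)
qed

text \<open>
  If two vertices chose the same edge, each would be the parent of the other, although depth strictly
  decreases from a vertex to its parent.
\<close>

lemma rooted_choices_inj_on:
  assumes "f \<in> rooted_choices G r"
  shows "inj_on f (verts G - {r})"
proof (rule inj_onI)
  fix v w assume v: "v \<in> verts G - {r}" and w: "w \<in> verts G - {r}" and eq: "f v = f w"
  have "joins G (f v) v (parent G r f v)" "joins G (f v) w (parent G r f w)"
    using rooted_choicesD(2)[OF assms, of v] rooted_choicesD(2)[OF assms, of w] v w eq by auto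
  from joins_same_ends[OF this] show "v = w"
    using rooted_choicesD(3)[OF assms, of v] rooted_choicesD(3)[OF assms, of w] v w by auto
qed

abbreviation with_arcs :: "('a, 'b) pre_digraph \<Rightarrow> 'b set \<Rightarrow> ('a, 'b) pre_digraph" where
  "with_arcs G A \<equiv> G\<lparr>arcs := A\<rparr>"

lemma spanning_iff_with_arcs:
  assumes "wf_digraph G"
  shows "spanning T G \<longleftrightarrow> (\<exists>A \<subseteq> arcs G. T = with_arcs G A)"
proof
  assume T: "spanning T G"
  then have "T = with_arcs G (arcs T)"
    by (intro pre_digraph.equality) (auto simp: spanning_def subgraph_def compatible_def)
  moreover have "arcs T \<subseteq> arcs G" using T by (auto simp: spanning_def subgraph_def)
  ultimately show "\<exists>A \<subseteq> arcs G. T = with_arcs G A" by blast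
next
  assume "\<exists>A \<subseteq> arcs G. T = with_arcs G A"
  then show "spanning T G"
    using assms by (auto simp: spanning_def subgraph_def compatible_def wf_digraph_def)
qed

lemma joins_with_arcs:
  "A \<subseteq> arcs G \<Longrightarrow> joins (with_arcs G A) e x y \<longleftrightarrow> e \<in> A \<and> joins G e x y"
  by (auto simp: joins_def)

lemma wf_with_arcs: "wf_digraph G \<Longrightarrow> A \<subseteq> arcs G \<Longrightarrow> wf_digraph (with_arcs G A)"
  by (auto simp: wf_digraph_def)

definition adjacency :: "('a, 'b) pre_digraph \<Rightarrow> ('a \<times> 'a) set" where
  "adjacency G = {(x, y). \<exists>e. joins G e x y}"

lemma sym_adjacency: "sym (adjacency G)"
  by (auto simp: adjacency_def sym_def joins_def)

lemma connected_iff_adjacency: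
  assumes "wf_digraph G" "r \<in> verts G"
  shows "connected G \<longleftrightarrow> (\<forall>v \<in> verts G. (v, r) \<in> (adjacency G)\<^sup>*)"
proof -
  have arcs: "arcs_ends (with_proj (mk_symmetric G)) = adjacency G"
    unfolding mk_symmetric_def arcs_ends_def arc_to_ends_def adjacency_def joins_def
    by (auto simp: image_iff)
  have eq: "u \<rightarrow>\<^sup>*\<^bsub>with_proj (mk_symmetric G)\<^esub> v \<longleftrightarrow> (u, v) \<in> (adjacency G)\<^sup>*"
    if "u \<in> verts G" for u v
  proof -
    have sub: "adjacency G \<subseteq> verts G \<times> verts G"
      using joins_verts[OF assms(1)] by (auto simp: adjacency_def)
    have "(u, v) \<in> rtrancl_on (verts G) (adjacency G)" if "(u, v) \<in> (adjacency G)\<^sup>*"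
      using that
    proof induction
      case base then show ?case using \<open>u \<in> verts G\<close> by (simp add: rtrancl_on_refl)
    next
      case (step y z) then show ?case using sub by (meson rtrancl_on_into_rtrancl_on mem_Sigma_iff subsetD)
    qed
    moreover have "(u, v) \<in> (adjacency G)\<^sup>*" if "(u, v) \<in> rtrancl_on (verts G) (adjacency G)"
      using that by (rule rtrancl_on_rtranclI)
    ultimately show ?thesis
      unfolding reachable_def arcs by (auto simp: mk_symmetric_def)
  qed
  have verts: "verts (with_proj (mk_symmetric G)) = verts G" by (simp add: mk_symmetric_def)
  have "connected G \<longleftrightarrow> (\<forall>u \<in> verts G. \<forall>v \<in> verts G. (u, v) \<in> (adjacency G)\<^sup>*)"
    unfolding connected_def strongly_connected_def verts using assms(2) eq by auto
  also have "\<dots> \<longleftrightarrow> (\<forall>v \<in> verts G. (v, r) \<in> (adjacency G)\<^sup>*)"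
    using assms(2) symD[OF sym_rtrancl[OF sym_adjacency[of G]]]
    by (meson rtrancl_trans)
  finally show ?thesis .
qed


definition simple_path :: "('a, 'b) pre_digraph \<Rightarrow> 'a list \<Rightarrow> 'b list \<Rightarrow> bool" where
  "simple_path G xs es \<longleftrightarrow> distinct xs \<and> length xs = Suc (length es) \<and>
     (\<forall>i < length es. joins G (es ! i) (xs ! i) (xs ! Suc i))"

text \<open>
  A simple path is extended edge by edge; when the new vertex already lies on it, the path is cut
  back to that vertex.
\<close>

lemma simple_path_exists:
  assumes "(x, y) \<in> (adjacency G)\<^sup>*"
  shows "\<exists>xs es. simple_path G xs es \<and> xs ! 0 = x \<and> xs ! length es = y"
  using assms
proof induction
  case base
  have "simple_path G [x] []" by (simp add: simple_path_def)
  then show ?case by (intro exI[of _ "[x]"] exI[of _ "[]"]) simp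
next
  case (step y z)
  then obtain xs es e where p: "simple_path G xs es" "xs ! 0 = x" "xs ! length es = y"
    and e: "joins G e y z" by (auto simp: adjacency_def)
  show ?case
  proof (cases "z \<in> set xs")
    case True
    then obtain i where i: "i < length xs" "xs ! i = z" by (auto simp: in_set_conv_nth)
    have "simple_path G (take (Suc i) xs) (take i es)"
      using p(1) i by (auto simp: simple_path_def)
    then show ?thesis
      using p i by (intro exI[of _ "take (Suc i) xs"] exI[of _ "take i es"])
        (auto simp: simple_path_def)
  next
    case False
    have "simple_path G (xs @ [z]) (es @ [e])"
      using p e False by (auto simp: simple_path_def nth_append less_Suc_eq)
    then show ?thesis
      using p by (intro exI[of _ "xs @ [z]"] exI[of _ "es @ [e]"])
        (auto simp: simple_path_def nth_append)
  qed
qed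

text \<open>
  The edge \<open>es ! i\<close> has the end set \<open>{xs ! i, xs ! Suc i}\<close>, and these sets differ for different \<open>i\<close>
  because the vertices of the path do.
\<close>

lemma simple_path_distinct_edges:
  assumes "simple_path G xs es"
  shows "distinct es"
proof -
  have "es ! i \<noteq> es ! j" if "i < j" "j < length es" for i j
  proof
    assume eq: "es ! i = es ! j"
    have "joins G (es ! i) (xs ! i) (xs ! Suc i)" "joins G (es ! j) (xs ! j) (xs ! Suc j)"
      using assms that by (simp_all add: simple_path_def)
    from joins_same_ends[OF this(1) this(2)[folded eq]] have "xs ! i = xs ! j \<or> xs ! i = xs ! Suc j" by auto
    moreover have "distinct xs" "i < length xs" "j < length xs" "Suc j < length xs"
      using assms that by (simp_all add: simple_path_def)
    ultimately show False using that by (auto simp: nth_eq_iff_index_eq)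
  qed
  then show ?thesis by (metis distinct_conv_nth linorder_neqE_nat)
qed

text \<open>
  A simple path in \<open>A\<close> is closed up by an edge outside \<open>A\<close> between its ends. This covers loops as well:
  for \<open>x = y\<close> the path is a single vertex and the cycle has length 1.
\<close>

lemma cycle_from_extra_edge:
  assumes "(x, y) \<in> (adjacency (with_arcs G A))\<^sup>*" "A \<subseteq> B" "B \<subseteq> arcs G"
    and "e \<in> B" "e \<notin> A" "joins G e y x"
  shows "\<exists>xs es. undirected_cycle (with_arcs G B) xs es"
proof -
  from simple_path_exists[OF assms(1)] obtain xs es where
    p: "simple_path (with_arcs G A) xs es" "xs ! 0 = x" "xs ! length es = y" by blast
  have A: "A \<subseteq> arcs G" using assms by auto
  have len: "length xs = Suc (length es)" using p by (simp add: simple_path_def)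
  have es: "es ! i \<in> A \<and> joins G (es ! i) (xs ! i) (xs ! Suc i)" if "i < length es" for i
    using p(1) that by (auto simp: simple_path_def joins_with_arcs[OF A])
  then have "set es \<subseteq> A" by (auto simp: in_set_conv_nth)
  then have dist: "distinct (es @ [e])"
    using simple_path_distinct_edges[OF p(1)] assms(5) by auto
  have "joins (with_arcs G B) ((es @ [e]) ! i) (xs ! i) (xs ! (Suc i mod length (es @ [e])))"
    if "i < length (es @ [e])" for i
  proof (cases "i < length es")
    case True
    then show ?thesis
      using es[OF True] assms(2) by (auto simp: joins_with_arcs[OF assms(3)] nth_append)
  next
    case False
    then have "i = length es" using that by simp
    then show ?thesis using p assms by (simp add: joins_with_arcs[OF assms(3)])
  qed
  then have "undirected_cycle (with_arcs G B) xs (es @ [e])"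
    using dist len p(1) by (auto simp: undirected_cycle_def simple_path_def)
  then show ?thesis by blast
qed

lemma reaches_root_imp_path:
  assumes G: "wf_digraph G" and f: "f \<in> edge_choices G r" and A: "f ` (verts G - {r}) \<subseteq> A" "A \<subseteq> arcs G"
    and "reaches_root G r f v" "v \<in> verts G"
  shows "(v, r) \<in> (adjacency (with_arcs G A))\<^sup>*"
proof -
  obtain m where "(parent G r f ^^ m) v = r" using assms by (auto simp: reaches_root_def)
  then show ?thesis using assms(6)
  proof (induction m arbitrary: v)
    case 0 then show ?case by simp
  next
    case (Suc m)
    show ?case
    proof (cases "v = r")
      case False
      then have inc: "f v \<in> incident G v" "f v \<in> A" using f A Suc.prems by (auto simp: edge_choices_def)
      then have j: "joins G (f v) v (parent G r f v)"
        using joins_opposite[OF inc(1)] False by (simp add: parent_def)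
      then have "parent G r f v \<in> verts G" using joins_verts[OF G] by blast
      moreover have "(parent G r f ^^ m) (parent G r f v) = r"
        using Suc.prems by (simp add: funpow_swap1)
      ultimately have "(parent G r f v, r) \<in> (adjacency (with_arcs G A))\<^sup>*" using Suc.IH by blast
      moreover have "(v, parent G r f v) \<in> adjacency (with_arcs G A)"
        using j inc(2) joins_with_arcs[OF A(2)] by (auto simp: adjacency_def)
      ultimately show ?thesis by (rule converse_rtrancl_into_rtrancl[rotated])
    qed simp
  qed
qed

abbreviation choice_graph :: "('a, 'b) pre_digraph \<Rightarrow> 'a \<Rightarrow> ('a \<Rightarrow> 'b) \<Rightarrow> ('a, 'b) pre_digraph" where
  "choice_graph G r f \<equiv> with_arcs G (f ` (verts G - {r}))"

lemma edge_choices_image: "f \<in> edge_choices G r \<Longrightarrow> f ` (verts G - {r}) \<subseteq> arcs G"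
  by (auto simp: edge_choices_def incident_def)

text \<open>
  All vertices are connected to the root through their ancestors. There is no cycle: every chosen
  edge is the parent edge of its deeper end, so at a vertex of maximal depth both cycle edges would
  have to be the parent edge of that vertex.
\<close>

lemma rooted_choice_tree:
  assumes G: "wf_digraph G" and r: "r \<in> verts G" and f: "f \<in> rooted_choices G r"
  shows "undirected_tree (choice_graph G r f)"
proof -
  let ?A = "f ` (verts G - {r})"
  let ?d = "depth G r f"
  have fe: "f \<in> edge_choices G r" and reach: "\<And>v. v \<in> verts G \<Longrightarrow> reaches_root G r f v"
    using f by (auto simp: rooted_choices_def)
  have A: "?A \<subseteq> arcs G" by (rule edge_choices_image[OF fe])
  have "connected (choice_graph G r f)"
    unfolding connected_iff_adjacency[OF wf_with_arcs[OF G A], of r, simplified, OF r]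
    using reaches_root_imp_path[OF G fe _ A] reach by auto
  moreover have False if cyc: "undirected_cycle (choice_graph G r f) xs es" for xs es
  proof -
    let ?n = "length es"
    have n: "?n > 0" "length xs = ?n" "distinct xs" "distinct es"
      using cyc by (auto simp: undirected_cycle_def)
    have edge: "es ! i \<in> ?A \<and> joins G (es ! i) (xs ! i) (xs ! (Suc i mod ?n))" if "i < ?n" for i
      using cyc that by (auto simp: undirected_cycle_def joins_with_arcs[OF A])
    have higher: "e = f x \<and> x \<noteq> r \<and> ?d y < ?d x" if e: "e \<in> ?A" and that: "joins G e x y" "?d y \<le> ?d x" for e x y
    proof -
      obtain w where w: "w \<in> verts G" "w \<noteq> r" "e = f w" using e by auto
      have "joins G e w (parent G r f w)" "?d w = Suc (?d (parent G r f w))"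
        using rooted_choicesD[OF f w(1,2)] w(3) by auto
      then show ?thesis using joins_same_ends[OF that(1)] that(2) w by fastforce
    qed
    obtain i where i: "i < ?n" "\<And>j. j < ?n \<Longrightarrow> ?d (xs ! j) \<le> ?d (xs ! i)"
    proof -
      let ?M = "Max ((\<lambda>j. ?d (xs ! j)) ` {..<?n})"
      have "?M \<in> (\<lambda>j. ?d (xs ! j)) ` {..<?n}" using n by (intro Max_in) auto
      then obtain i where "i < ?n" "?M = ?d (xs ! i)" by auto
      moreover have "?d (xs ! j) \<le> ?M" if "j < ?n" for j using that by (intro Max_ge) auto
      ultimately show ?thesis using that by metis
    qed
    \<comment> \<open>\<open>j\<close> is the cyclic predecessor of \<open>i\<close>, so the edges \<open>i\<close> and \<open>j\<close> are the two cycle edges at \<open>xs ! i\<close>.\<close>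
    define j where "j = (i + ?n - 1) mod ?n"
    have j: "j < ?n" "Suc j mod ?n = i"
      using n(1) i(1) by (auto simp: j_def mod_Suc_eq)
    have 1: "es ! i = f (xs ! i) \<and> ?d (xs ! (Suc i mod ?n)) < ?d (xs ! i)"
      using higher[of "es ! i" "xs ! i" "xs ! (Suc i mod ?n)"] edge[OF i(1)] i(2)[of "Suc i mod ?n"] n(1)
      by simp
    have "joins G (es ! j) (xs ! i) (xs ! j)"
      using edge[OF j(1)] joins_sym unfolding j(2) by metis
    then have 2: "es ! j = f (xs ! i) \<and> ?d (xs ! j) < ?d (xs ! i)"
      using higher[of "es ! j" "xs ! i" "xs ! j"] edge[OF j(1)] i(2)[OF j(1)] by simp
    then have "i = j" using 1 n(4) i(1) j(1) by (metis nth_eq_iff_index_eq)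
    then show False using 2 by simp
  qed
  ultimately show ?thesis unfolding undirected_tree_def by blast
qed

text \<open>
  By induction on the depth in \<open>f\<close>. If the edge \<open>f w\<close> is not chosen by \<open>g\<close> at \<open>w\<close>, then it is chosen by
  \<open>g\<close> at the parent of \<open>w\<close>, where \<open>f\<close> and \<open>g\<close> agree. So \<open>f\<close> chooses the same edge at \<open>w\<close> and at its
  parent, against injectivity.
\<close>

lemma rooted_choices_determined_by_image:
  assumes f: "f \<in> rooted_choices G r" and g: "g \<in> rooted_choices G r"
    and img: "f ` (verts G - {r}) = g ` (verts G - {r})"
  shows "f = g"
proof -
  have "f w = g w" if "w \<in> verts G - {r}" for w
    using that
  proof (induction "depth G r f w" arbitrary: w rule: less_induct)
    case less
    let ?p = "parent G r f w"
    have w: "w \<in> verts G" "w \<noteq> r" using less.prems by auto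
    note fw = rooted_choicesD[OF f w]
    have "f w \<in> g ` (verts G - {r})" using img less.prems by blast
    then obtain w' where w': "w' \<in> verts G" "w' \<noteq> r" "f w = g w'" by auto
    note gw' = rooted_choicesD[OF g w'(1,2)]
    have "w' = w \<or> w' = ?p" using joins_same_ends[OF fw(2), of w'] gw'(2) w'(3) by auto
    moreover have False if "w' = ?p"
    proof -
      have "f ?p = g ?p" using less.hyps[of ?p] fw(3) w' that by auto
      then have "f ?p = f w" using w' that by simp
      then have "?p = w" using inj_onD[OF rooted_choices_inj_on[OF f], of ?p w] w w' that by auto
      then show False using fw(3) by simp
    qed
    ultimately show ?case using w' by auto
  qed
  then show ?thesis
    using f g by (auto simp: rooted_choices_def edge_choices_def intro: PiE_ext)
qed

text \<open>
  Every vertex chooses a tree edge towards the root, that is, one that decreases the distance to the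
  root in the tree. These edges already connect all vertices, so any further edge of the tree would
  close a cycle.
\<close>

lemma tree_has_rooted_choice:
  assumes G: "wf_digraph G" and r: "r \<in> verts G" and A: "A \<subseteq> arcs G"
    and T: "undirected_tree (with_arcs G A)"
  shows "\<exists>f \<in> rooted_choices G r. f ` (verts G - {r}) = A"
proof -
  let ?R = "adjacency (with_arcs G A)"
  define dist where "dist v = (LEAST n. (v, r) \<in> ?R ^^ n)" for v
  have conn: "(v, r) \<in> ?R\<^sup>*" if "v \<in> verts G" for v
    using T that connected_iff_adjacency[OF wf_with_arcs[OF G A], of r] r
    by (auto simp: undirected_tree_def)
  have closer: "\<exists>e. e \<in> A \<and> e \<in> incident G v \<and> dist (opposite G e v) < dist v"
    if v: "v \<in> verts G" "v \<noteq> r" for v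
  proof -
    obtain n where "(v, r) \<in> ?R ^^ n" using conn[OF v(1)] by (auto simp: rtrancl_power)
    then have d: "(v, r) \<in> ?R ^^ dist v" unfolding dist_def by (rule LeastI)
    then obtain m where m: "dist v = Suc m" using v(2) by (cases "dist v") auto
    with d obtain y where y: "(v, y) \<in> ?R" "(y, r) \<in> ?R ^^ m" by (metis relpow_Suc_D2)
    then obtain e where e: "e \<in> A" "joins G e v y"
      using joins_with_arcs[OF A] by (auto simp: adjacency_def)
    have "dist y \<le> m" 
      unfolding dist_def by (rule Least_le[where P = "\<lambda>n. (y, r) \<in> ?R ^^ n", OF y(2)])
    then show ?thesis using e m joins_imp_incident[OF e(2)] joins_imp_opposite[OF e(2)] by auto
  qed
  define f where "f = restrict (\<lambda>v. SOME e. e \<in> A \<and> e \<in> incident G v \<and> dist (opposite G e v) < dist v)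
      (verts G - {r})"
  have fv: "f v \<in> A \<and> f v \<in> incident G v \<and> dist (opposite G (f v) v) < dist v"
    if "v \<in> verts G" "v \<noteq> r" for v
    using someI_ex[OF closer[OF that]] that by (simp add: f_def)
  have fe: "f \<in> edge_choices G r"
    unfolding edge_choices_def using fv by (auto simp: f_def)
  have reach: "reaches_root G r f v" if "v \<in> verts G" for v
    using that
  proof (induction "dist v" arbitrary: v rule: less_induct)
    case less
    show ?case
    proof (cases "v = r")
      case False
      then have "dist (parent G r f v) < dist v" "parent G r f v \<in> verts G"
        using fv[OF less.prems False] opposite_in_verts[OF G] by (auto simp: parent_def)
      then show ?thesis using less.hyps reaches_root_parent by metis
    qed simp
  qed
  have f: "f \<in> rooted_choices G r" using fe reach by (simp add: rooted_choices_def)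
  let ?B = "f ` (verts G - {r})"
  have B: "?B \<subseteq> A" using fv by auto
  have "e \<in> ?B" if e: "e \<in> A" for e
  proof (rule ccontr)
    assume "e \<notin> ?B"
    have "e \<in> arcs G" using e A by auto
    then have j: "joins G e (head G e) (tail G e)" by (simp add: joins_def)
    have ends: "head G e \<in> verts G" "tail G e \<in> verts G" using joins_verts[OF G j] by auto
    have "(x, r) \<in> (adjacency (with_arcs G ?B))\<^sup>*" if "x \<in> verts G" for x
      by (rule reaches_root_imp_path[OF G fe order_refl _ reach[OF that] that]) (use B A in auto)
    then have "(tail G e, head G e) \<in> (adjacency (with_arcs G ?B))\<^sup>*"
      using ends symD[OF sym_rtrancl[OF sym_adjacency]] by (meson rtrancl_trans)
    from cycle_from_extra_edge[OF this B A e \<open>e \<notin> ?B\<close> j] show False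
      using T by (auto simp: undirected_tree_def)
  qed
  then show ?thesis using f B by blast
qed

theorem num_spanning_trees_eq_card_rooted_choices:
  assumes G: "wf_digraph G" and r: "r \<in> verts G"
  shows "num_spanning_trees G = card (rooted_choices G r)"
proof -
  have "bij_betw (choice_graph G r) (rooted_choices G r) {T. spanning T G \<and> undirected_tree T}"
  proof (rule bij_betw_imageI)
    show "inj_on (choice_graph G r) (rooted_choices G r)"
    proof (rule inj_onI)
      fix f g assume fg: "f \<in> rooted_choices G r" "g \<in> rooted_choices G r"
        and "choice_graph G r f = choice_graph G r g"
      then have "arcs (choice_graph G r f) = arcs (choice_graph G r g)" by simp
      then show "f = g" using rooted_choices_determined_by_image[OF fg] by simp
    qed
    show "choice_graph G r ` rooted_choices G r = {T. spanning T G \<and> undirected_tree T}"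
    proof (intro equalityI subsetI)
      fix T assume "T \<in> choice_graph G r ` rooted_choices G r"
      then obtain f where f: "f \<in> rooted_choices G r" "T = choice_graph G r f" by blast
      then have "f ` (verts G - {r}) \<subseteq> arcs G"
        using edge_choices_image[of f G r] by (simp add: rooted_choices_def)
      then show "T \<in> {T. spanning T G \<and> undirected_tree T}"
        using rooted_choice_tree[OF G r f(1)] f(2) by (auto simp: spanning_iff_with_arcs[OF G])
    next
      fix T assume "T \<in> {T. spanning T G \<and> undirected_tree T}"
      then obtain A where "A \<subseteq> arcs G" "T = with_arcs G A" "undirected_tree T"
        by (auto simp: spanning_iff_with_arcs[OF G])
      then show "T \<in> choice_graph G r ` rooted_choices G r"
        using tree_has_rooted_choice[OF G r] by auto
    qed
  qed
  then show ?thesis unfolding num_spanning_trees_def by (simp add: bij_betw_same_card)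
qed

section \<open>Determinants\<close>

text \<open>
  Multilinearity in all rows at once: a determinant whose rows are sums is the sum of the determinants
  in which every row is one chosen summand. The rows carry labels \<open>vs i\<close>, so that the choices
  are functions on the labels (later: the vertices) and not on the row numbers.
\<close>

lemma det_sum_rows:
  fixes b :: "'v \<Rightarrow> 'c \<Rightarrow> nat \<Rightarrow> 'a :: comm_ring_1"
  assumes bij: "bij_betw vs {0..<N} V" and fin: "\<And>v. v \<in> V \<Longrightarrow> finite (C v)"
  shows "det (mat N N (\<lambda>(i, j). \<Sum>c \<in> C (vs i). b (vs i) c j)) =
    (\<Sum>f \<in> Pi\<^sub>E V C. det (mat N N (\<lambda>(i, j). b (vs i) (f (vs i)) j)))"
proof -
  define idx where "idx = inv_into {0..<N} vs"
  have idx: "idx (vs i) = i" if "i < N" for i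
    using bij that by (simp add: idx_def bij_betw_inv_into_left)
  have finV: "finite V" using bij bij_betw_finite by blast
  have expand: "(\<Prod>i = 0..<N. \<Sum>c \<in> C (vs i). b (vs i) c (p i)) =
      (\<Sum>f \<in> Pi\<^sub>E V C. \<Prod>i = 0..<N. b (vs i) (f (vs i)) (p i))" for p
  proof -
    have "(\<Prod>i = 0..<N. \<Sum>c \<in> C (vs i). b (vs i) c (p i)) =
        (\<Prod>i = 0..<N. \<Sum>c \<in> C (vs i). b (vs i) c (p (idx (vs i))))"
      by (intro prod.cong) (auto simp: idx)
    also have "\<dots> = (\<Prod>v \<in> V. \<Sum>c \<in> C v. b v c (p (idx v)))"
      by (rule prod.reindex_bij_betw[OF bij])
    also have "\<dots> = (\<Sum>f \<in> Pi\<^sub>E V C. \<Prod>v \<in> V. b v (f v) (p (idx v)))"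
      by (rule prod_sum_PiE[OF finV fin])
    also have "\<dots> = (\<Sum>f \<in> Pi\<^sub>E V C. \<Prod>i = 0..<N. b (vs i) (f (vs i)) (p (idx (vs i))))"
      by (subst prod.reindex_bij_betw[OF bij, symmetric]) (rule refl)
    also have "\<dots> = (\<Sum>f \<in> Pi\<^sub>E V C. \<Prod>i = 0..<N. b (vs i) (f (vs i)) (p i))"
      by (intro sum.cong prod.cong) (auto simp: idx)
    finally show ?thesis .
  qed
  have det: "det (mat N N (\<lambda>(i, j). g i j)) =
      (\<Sum>p \<in> {p. p permutes {0..<N}}. signof p * (\<Prod>i = 0..<N. g i (p i)))"
    for g :: "nat \<Rightarrow> nat \<Rightarrow> 'a"
    by (subst det_def'[of _ N], simp, intro sum.cong refl arg_cong2[of _ _ _ _ "(*)"] prod.cong)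
      (auto simp: permutes_in_image)
  show ?thesis
    unfolding det expand sum_distrib_left by (rule sum.swap)
qed

text \<open>
  The matrix with the blocks \<open>1\<close>, \<open>- A\<close>, \<open>B\<close>, \<open>1\<close> is both \<open>?L * ?U\<close> and \<open>?U' * ?L\<close>, products of block triangular
  matrices whose determinants are the two sides.
\<close>

lemma sylvester_det_identity:
  fixes A :: "'a :: idom mat"
  assumes A: "A \<in> carrier_mat n m" and B: "B \<in> carrier_mat m n"
  shows "det (1\<^sub>m n + A * B) = det (1\<^sub>m m + B * A)"
proof -
  let ?L = "four_block_mat (1\<^sub>m n) (0\<^sub>m n m) B (1\<^sub>m m)"
  let ?U = "four_block_mat (1\<^sub>m n) (- A) (0\<^sub>m m n) (1\<^sub>m m + B * A)"
  let ?U' = "four_block_mat (1\<^sub>m n + A * B) (- A) (0\<^sub>m m n) (1\<^sub>m m)"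
  have L: "?L \<in> carrier_mat (n + m) (n + m)" and U: "?U \<in> carrier_mat (n + m) (n + m)"
    and U': "?U' \<in> carrier_mat (n + m) (n + m)"
    using A B by auto
  have BA: "B * A \<in> carrier_mat m m" and AB: "A * B \<in> carrier_mat n n" using A B by auto
  have "?L * ?U = four_block_mat (1\<^sub>m n) (- A) B (1\<^sub>m m)"
    using A B BA by (subst mult_four_block_mat[of _ n n _ m _ m _ _ n _ m])
      (auto intro!: cong_four_block_mat eq_matI)
  moreover have "?U' * ?L = four_block_mat (1\<^sub>m n) (- A) B (1\<^sub>m m)"
    using A B AB by (subst mult_four_block_mat[of _ n n _ m _ m _ _ n _ m])
      (auto intro!: cong_four_block_mat eq_matI)
  ultimately have "det ?L * det ?U = det ?U' * det ?L"
    by (metis det_mult[OF L U] det_mult[OF U' L])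
  moreover have "det ?L = 1"
    using B by (subst det_four_block_mat_upper_right_zero[of _ n _ m]) auto
  moreover have "det ?U = det (1\<^sub>m m + B * A)"
    using A BA by (subst det_four_block_mat_lower_left_zero[of _ n _ m]) auto
  moreover have "det ?U' = det (1\<^sub>m n + A * B)"
    using A AB by (subst det_four_block_mat_lower_left_zero[of _ n _ m]) auto
  ultimately show ?thesis by simp
qed

text \<open>
  The new matrix is \<open>(1 + a b\<^sup>T) M\<close> for the column vectors \<open>a\<close> and \<open>b\<close>, and Sylvester's identity reduces
  \<open>det (1 + a b\<^sup>T)\<close> to a \<open>1 \<times> 1\<close> determinant.
\<close>

lemma det_add_combination_to_rows:
  fixes M :: "nat \<Rightarrow> nat \<Rightarrow> 'a :: idom"
  shows "det (mat N N (\<lambda>(i, j). M i j + a i * (\<Sum>k < N. b k * M k j))) =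
    (1 + (\<Sum>k < N. b k * a k)) * det (mat N N (\<lambda>(i, j). M i j))"
proof -
  let ?M = "mat N N (\<lambda>(i, j). M i j)"
  let ?a = "mat N 1 (\<lambda>(i, _). a i)" and ?b = "mat 1 N (\<lambda>(_, j). b j)"
  have "mat N N (\<lambda>(i, j). M i j + a i * (\<Sum>k < N. b k * M k j)) = (1\<^sub>m N + ?a * ?b) * ?M"
  proof -
    have "?M + ?a * (?b * ?M) = (1\<^sub>m N + ?a * ?b) * ?M"
      by (subst add_mult_distrib_mat[of _ N N]) (auto simp: assoc_mult_mat[of _ N 1 _ N _ N])
    moreover have "mat N N (\<lambda>(i, j). M i j + a i * (\<Sum>k < N. b k * M k j)) = ?M + ?a * (?b * ?M)"
      by (rule eq_matI) (auto simp: scalar_prod_def atLeast0LessThan)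
    ultimately show ?thesis by simp
  qed
  moreover have "det (1\<^sub>m N + ?a * ?b) = 1 + (\<Sum>k < N. b k * a k)"
    by (subst sylvester_det_identity[of _ N 1], simp, simp, subst det_single)
      (auto simp: scalar_prod_def atLeast0LessThan)
  moreover have "det ((1\<^sub>m N + ?a * ?b) * ?M) = det (1\<^sub>m N + ?a * ?b) * det ?M"
    by (rule det_mult[of _ N]) auto
  ultimately show ?thesis by simp
qed

text \<open>
  For a matrix \<open>L\<close> with vanishing row and column sums, every rank-one update \<open>L + u u\<^sup>T\<close> has the same
  determinant up to the factor \<open>(\<Sum> u)\<^sup>2\<close>. With \<open>e\<close> the unit vector at \<open>r\<close> and \<open>L'\<close> the matrix \<open>L\<close> with row
  \<open>r\<close> replaced by \<open>e\<^sup>T\<close>, the proof passes from \<open>L'\<close> through \<open>L + e e\<^sup>T\<close> and \<open>L + u e\<^sup>T\<close> to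
  \<open>L + u u\<^sup>T\<close>. Each step adds multiples of one combination of rows (in the last step: columns) to all of
  them; the determinant is multiplied by \<open>1\<close>, \<open>\<Sum> u\<close> and \<open>\<Sum> u\<close>.
\<close>

lemma det_rank_one_update_of_zero_sums:
  fixes L :: "nat \<Rightarrow> nat \<Rightarrow> 'a :: idom"
  assumes r: "r < N"
    and rows: "\<And>i. i < N \<Longrightarrow> (\<Sum>j < N. L i j) = 0"
    and cols: "\<And>j. j < N \<Longrightarrow> (\<Sum>i < N. L i j) = 0"
  shows "det (mat N N (\<lambda>(i, j). L i j + u i * u j)) =
    (\<Sum>i < N. u i)\<^sup>2 * det (mat N N (\<lambda>(i, j). if i = r then of_bool (i = j) else L i j))"
proof -
  define e :: "nat \<Rightarrow> 'a" where "e i = of_bool (i = r)" for i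
  have sum_e: "(\<Sum>i < N. e i) = 1"
    using r by (simp add: e_def sum.delta' of_bool_def)
  let ?L' = "\<lambda>i j. if i = r then of_bool (i = j) else L i j"
  \<comment> \<open>As the columns of \<open>L\<close> sum to zero, row \<open>r\<close> of \<open>L\<close> is minus the sum of the other rows.\<close>
  have other: "(\<Sum>k < N. (e k - 1) * ?L' k j) = L r j" if "j < N" for j
  proof -
    have "(\<Sum>k < N. (e k - 1) * ?L' k j) = (\<Sum>k \<in> {..<N} - {r}. - L k j)"
      using r by (subst sum.remove[of _ r]) (auto simp: e_def intro!: sum.cong)
    also have "\<dots> = L r j" using cols[OF that] r by (subst (asm) sum.remove[of _ r]) (auto simp: sum_negf add_eq_0_iff)
    finally show ?thesis .
  qed
  have "det (mat N N (\<lambda>(i, j). L i j + e i * e j)) =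
      det (mat N N (\<lambda>(i, j). ?L' i j + e i * (\<Sum>k < N. (e k - 1) * ?L' k j)))"
    by (intro arg_cong[of _ _ det] cong_mat) (auto simp: other, auto simp: e_def)
  also have "\<dots> = (1 + (\<Sum>k < N. (e k - 1) * e k)) * det (mat N N (\<lambda>(i, j). ?L' i j))"
    by (rule det_add_combination_to_rows)
  also have "(\<Sum>k < N. (e k - 1) * e k) = 0" by (intro sum.neutral) (auto simp: e_def)
  finally have 1: "det (mat N N (\<lambda>(i, j). L i j + e i * e j)) = det (mat N N (\<lambda>(i, j). ?L' i j))"
    by simp
  have factor: "1 + (\<Sum>k < N. 1 * (u k - e k)) = (\<Sum>k < N. u k)"
    using sum_e by (simp add: sum_subtractf)
  have "(\<Sum>k < N. 1 * (L k j + e k * e j)) = e j" if "j < N" for j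
    using cols[OF that] sum_e by (simp add: sum.distrib flip: sum_distrib_right)
  then have "det (mat N N (\<lambda>(i, j). L i j + u i * e j)) =
      det (mat N N (\<lambda>(i, j). (L i j + e i * e j) + (u i - e i) * (\<Sum>k < N. 1 * (L k j + e k * e j))))"
    by (intro arg_cong[of _ _ det] cong_mat) (auto simp: algebra_simps)
  also have "\<dots> = (\<Sum>k < N. u k) * det (mat N N (\<lambda>(i, j). L i j + e i * e j))"
    by (subst det_add_combination_to_rows) (simp add: factor[simplified])
  finally have 2: "det (mat N N (\<lambda>(i, j). L i j + u i * e j)) =
      (\<Sum>k < N. u k) * det (mat N N (\<lambda>(i, j). L i j + e i * e j))" .
  have transp: "det (mat N N (\<lambda>(i, j). g j i)) = det (mat N N (\<lambda>(i, j). g i j))"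
    for g :: "nat \<Rightarrow> nat \<Rightarrow> 'a"
    by (subst det_transpose[of _ N, symmetric]) (auto intro!: arg_cong[of _ _ det] eq_matI)
  have "(\<Sum>k < N. 1 * (L j k + u j * e k)) = u j" if "j < N" for j
    using rows[OF that] sum_e by (simp add: sum.distrib flip: sum_distrib_left)
  then have "det (mat N N (\<lambda>(i, j). L j i + u j * u i)) =
      det (mat N N (\<lambda>(i, j). (L j i + u j * e i) + (u i - e i) * (\<Sum>k < N. 1 * (L j k + u j * e k))))"
    by (intro arg_cong[of _ _ det] cong_mat) (auto simp: algebra_simps)
  also have "\<dots> = (\<Sum>k < N. u k) * det (mat N N (\<lambda>(i, j). L j i + u j * e i))"
    by (subst det_add_combination_to_rows) (simp add: factor[simplified])
  finally have "det (mat N N (\<lambda>(i, j). L i j + u i * u j)) =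
      (\<Sum>k < N. u k) * det (mat N N (\<lambda>(i, j). L i j + u i * e j))"
    by (simp only: transp[of "\<lambda>i j. L i j + u i * u j"] transp[of "\<lambda>i j. L i j + u i * e j"])
  then show ?thesis unfolding 2 1 by (simp add: power2_eq_square)
qed

section \<open>The matrix-tree theorem\<close>

text \<open>
  The entry is written as a sum over the edges at \<open>v\<close>, not as degree minus adjacency, because the proof of
  the matrix-tree theorem splits each row into exactly these summands.
\<close>

definition laplacian :: "('a, 'b) pre_digraph \<Rightarrow> 'a \<Rightarrow> 'a \<Rightarrow> 'c :: comm_ring_1" where
  "laplacian G v w = (\<Sum>e \<in> incident G v. of_bool (v = w) - of_bool (opposite G e v = w))"

lemma laplacian_sym:
  assumes "fin_digraph G"
  shows "laplacian G v w = laplacian G w v"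
proof (cases "v = w")
  case False
  have fin: "finite (incident G v)" for v
    using assms by (auto simp: incident_def fin_digraph_def fin_digraph_axioms_def)
  have off: "laplacian G v w = - of_nat (card {e. joins G e v w})" if "v \<noteq> w" for v w
  proof -
    have "{e \<in> incident G v. opposite G e v = w} = {e. joins G e v w}"
      using joins_opposite joins_imp_incident joins_imp_opposite by metis
    then show ?thesis
      using that fin by (simp add: laplacian_def sum_negf Int_def)
  qed
  have "{e. joins G e v w} = {e. joins G e w v}" by (blast intro: joins_sym)
  then show ?thesis using False by (simp add: off)
qed simp

lemma sum_laplacian_row:
  assumes "fin_digraph G" "v \<in> verts G"
  shows "(\<Sum>w \<in> verts G. laplacian G v w) = 0"
proof -
  interpret fin_digraph G by fact
  have "(\<Sum>w \<in> verts G. laplacian G v w) =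
      (\<Sum>e \<in> incident G v. \<Sum>w \<in> verts G. of_bool (v = w) - of_bool (opposite G e v = w))"
    unfolding laplacian_def by (rule sum.swap)
  also have "\<dots> = 0"
    using assms(2) opposite_in_verts[OF wf_digraph_axioms]
    by (intro sum.neutral) (auto simp: sum_subtractf of_bool_def)
  finally show ?thesis .
qed

text \<open>
  If every vertex reaches the root, only the identity contributes to the Leibniz expansion: a
  permutation with a nonzero term sends each vertex to itself or to its parent, and by induction on the
  depth the parent is already a fixed point. Otherwise, the indicator function of the vertices
  that do not reach the root takes the same value at a vertex and at its parent and vanishes at the
  root, so it lies in the kernel.
\<close>

lemma det_choice_matrix:
  assumes G: "wf_digraph G" and r: "r \<in> verts G" and bij: "bij_betw vs {0..<N} (verts G)"
    and f: "f \<in> edge_choices G r"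
  shows "det (mat N N (\<lambda>(i, j). of_bool (i = j) - of_bool (vs i \<noteq> r \<and> parent G r f (vs i) = vs j)))
    = (if f \<in> rooted_choices G r then 1 else 0 :: 'c :: idom)"
    (is "det ?M = _")
proof -
  have M: "?M \<in> carrier_mat N N" by simp
  have par: "parent G r f v \<in> verts G" if "v \<in> verts G" for v
    using that f r opposite_in_verts[OF G] by (auto simp: parent_def edge_choices_def)
  have vs: "vs i \<in> verts G" if "i < N" for i
    using bij that by (auto simp: bij_betw_def)
  have inj: "vs i = vs j \<longleftrightarrow> i = j" if "i < N" "j < N" for i j
    using bij that by (auto simp: bij_betw_def inj_on_eq_iff)
  have surj: "\<exists>i < N. vs i = v" if "v \<in> verts G" for v
    using bij that by (force simp: bij_betw_def)
  show ?thesis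
  proof (cases "f \<in> rooted_choices G r")
    case True
    then have reach: "reaches_root G r f v" if "v \<in> verts G" for v
      using that by (auto simp: rooted_choices_def)
    have zero: "(\<Prod>i = 0..<N. ?M $$ (i, p i)) = 0" if p: "p permutes {0..<N}" "p \<noteq> id" for p
    proof (rule ccontr)
      assume nz: "(\<Prod>i = 0..<N. ?M $$ (i, p i)) \<noteq> 0"
      have pN: "p i < N" if "i < N" for i using p(1) that permutes_in_image by fastforce
      have entry: "p i = i \<or> vs i \<noteq> r \<and> vs (p i) = parent G r f (vs i)" if "i < N" for i
      proof -
        have "?M $$ (i, p i) \<noteq> 0" using nz that by auto
        then show ?thesis using that pN[OF that] by (auto split: if_splits)
      qed
      have "p i = i" if "i < N" for i
        using that
      proof (induction "depth G r f (vs i)" arbitrary: i rule: less_induct)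
        case less
        show ?case
        proof (rule ccontr)
          assume "p i \<noteq> i"
          then have i: "vs i \<noteq> r" "vs (p i) = parent G r f (vs i)" using entry[OF less.prems] by auto
          then have "depth G r f (vs (p i)) < depth G r f (vs i)"
            using depth_parent[OF reach[OF vs[OF less.prems]]] by simp
          then have "p (p i) = p i" using less.hyps pN[OF less.prems] by blast
          then show False using \<open>p i \<noteq> i\<close> permutes_inj[OF p(1)] by (auto dest: injD)
        qed
      qed
      then have "p = id" using p(1) by (auto simp: permutes_def fun_eq_iff)
      then show False using p(2) by simp
    qed
    have "det ?M = (\<Sum>p \<in> {p. p permutes {0..<N}}. signof p * (\<Prod>i = 0..<N. ?M $$ (i, p i)))"
      by (rule det_def'[OF M])
    also have "\<dots> = (\<Sum>p \<in> {id}. signof p * (\<Prod>i = 0..<N. ?M $$ (i, p i)))"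
      using zero by (intro sum.mono_neutral_right) (auto simp: finite_permutations permutes_id)
    also have "\<dots> = (\<Prod>i = 0..<N. ?M $$ (i, i))" by simp
    also have "\<dots> = 1"
    proof (intro prod.neutral ballI)
      fix i assume "i \<in> {0..<N}"
      then show "?M $$ (i, i) = 1"
        using parent_neq[OF reach[OF vs]] by auto
    qed
    finally show ?thesis using True by simp
  next
    case False
    define x where "x = vec N (\<lambda>i. of_bool (\<not> reaches_root G r f (vs i)) :: 'c)"
    obtain v where "v \<in> verts G" "\<not> reaches_root G r f v"
      using False f by (auto simp: rooted_choices_def)
    then obtain i where i: "i < N" "\<not> reaches_root G r f (vs i)" using surj by metis
    have "x \<noteq> 0\<^sub>v N"
    proof
      assume "x = 0\<^sub>v N"
      then have "x $ i = 0" using i(1) by simp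
      then show False using i by (simp add: x_def)
    qed
    moreover have "?M *\<^sub>v x = 0\<^sub>v N"
    proof (rule eq_vecI)
      fix i assume "i < dim_vec (0\<^sub>v N :: 'c vec)"
      then have i: "i < N" by simp
      obtain k where k: "k < N" "vs k = parent G r f (vs i)" using surj par vs i by metis
      have "(?M *\<^sub>v x) $ i = (\<Sum>j < N. (of_bool (i = j) - of_bool (vs i \<noteq> r \<and> k = j)) * x $ j)"
        using i k inj by (auto simp: scalar_prod_def atLeast0LessThan x_def intro!: sum.cong)
      also have "\<dots> = x $ i - (if vs i = r then 0 else x $ k)"
      proof -
        have "(\<Sum>j < N. of_bool (c = j) * x $ j) = x $ c" if "c < N" for c
          using sum.delta'[of "{..<N}" c "\<lambda>j. x $ j"] that by (simp add: of_bool_def if_distrib[of "\<lambda>t. t * _"] cong: if_cong)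
        then show ?thesis
          using i k by (cases "vs i = r") (simp_all add: left_diff_distrib sum_subtractf)
      qed
      also have "\<dots> = 0"
      proof (cases "vs i = r")
        case True
        then show ?thesis using i by (simp add: x_def)
      next
        case False
        then show ?thesis using i k(1) by (simp add: x_def k(2) reaches_root_parent)
      qed
      finally show "(?M *\<^sub>v x) $ i = 0\<^sub>v N $ i" using i by simp
    qed simp
    moreover have "x \<in> carrier_vec N" by (simp add: x_def)
    ultimately have "det ?M = 0" using det_0_iff_vec_prod_zero[OF M] by blast
    then show ?thesis using False by simp
  qed
qed

text \<open>
  Replacing the row of the root by a unit vector has the same effect on the determinant as deleting the row
  and the column of the root, but keeps the indices unchanged.
\<close>

theorem matrix_tree:
  assumes G: "fin_digraph G" and r: "r \<in> verts G" and bij: "bij_betw vs {0..<N} (verts G)"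
  shows "det (mat N N (\<lambda>(i, j). if vs i = r then of_bool (i = j) else laplacian G (vs i) (vs j)))
    = (of_nat (num_spanning_trees G) :: 'c :: idom)"
proof -
  interpret fin_digraph G by fact
  \<comment> \<open>At the root there is a single dummy choice, which is the value of extensional functions there.\<close>
  let ?C = "\<lambda>v. if v = r then {undefined} else incident G v"
  let ?b = "\<lambda>v e j. of_bool (v = vs j) - of_bool (v \<noteq> r \<and> opposite G e v = vs j) :: 'c"
  let ?M = "\<lambda>f. mat N N (\<lambda>(i, j). of_bool (i = j) - of_bool (vs i \<noteq> r \<and> parent G r f (vs i) = vs j)) :: 'c mat"
  have inj: "vs i = vs j \<longleftrightarrow> i = j" if "i < N" "j < N" for i j
    using bij that by (auto simp: bij_betw_def inj_on_eq_iff)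
  have fin: "finite (incident G v)" for v by (auto simp: incident_def)
  have choices: "Pi\<^sub>E (verts G) ?C = edge_choices G r"
  proof (intro equalityI subsetI)
    fix f assume f: "f \<in> Pi\<^sub>E (verts G) ?C"
    then have "f r = undefined" using PiE_mem[OF f r] by simp
    moreover have "f v = undefined" if "v \<notin> verts G" for v using PiE_arb[OF f that] .
    moreover have "f v \<in> incident G v" if "v \<in> verts G" "v \<noteq> r" for v
      using PiE_mem[OF f that(1)] that(2) by simp
    ultimately show "f \<in> edge_choices G r"
      unfolding edge_choices_def by (intro PiE_I) blast+
  next
    fix f assume "f \<in> edge_choices G r"
    then have f: "f \<in> (\<Pi>\<^sub>E v \<in> verts G - {r}. incident G v)" by (simp add: edge_choices_def)
    show "f \<in> Pi\<^sub>E (verts G) ?C"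
      using PiE_mem[OF f] PiE_arb[OF f] by (intro PiE_I) simp_all
  qed
  have "(if vs i = r then of_bool (i = j) else laplacian G (vs i) (vs j)) =
      (\<Sum>e \<in> ?C (vs i). ?b (vs i) e j)" if "i < N" "j < N" for i j
    by (cases "vs i = r") (simp_all add: laplacian_def flip: inj[OF that])
  then have "mat N N (\<lambda>(i, j). if vs i = r then of_bool (i = j) else laplacian G (vs i) (vs j)) =
      mat N N (\<lambda>(i, j). \<Sum>e \<in> ?C (vs i). ?b (vs i) e j)"
    by (intro cong_mat) (simp_all only: case_prod_conv)
  then have "det (mat N N (\<lambda>(i, j). if vs i = r then of_bool (i = j) else laplacian G (vs i) (vs j))) =
      (\<Sum>f \<in> edge_choices G r. det (mat N N (\<lambda>(i, j). ?b (vs i) (f (vs i)) j)))"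
    using det_sum_rows[OF bij, of ?C ?b] fin choices by simp
  also have "\<dots> = (\<Sum>f \<in> edge_choices G r. det (?M f))"
    by (intro sum.cong refl arg_cong[of _ _ det] cong_mat)
      (simp_all add: inj parent_def cong: conj_cong)
  also have "\<dots> = (\<Sum>f \<in> edge_choices G r. if f \<in> rooted_choices G r then 1 else 0)"
    by (intro sum.cong refl det_choice_matrix[OF wf_digraph_axioms r bij])
  also have "\<dots> = of_nat (card (rooted_choices G r))"
  proof -
    have "finite (edge_choices G r)" unfolding edge_choices_def using fin by (intro finite_PiE) auto
    moreover have "{f \<in> edge_choices G r. f \<in> rooted_choices G r} = rooted_choices G r"
      by (auto simp: rooted_choices_def)
    ultimately show ?thesis by (simp flip: sum.inter_filter)
  qed
  finally show ?thesis
    by (simp add: num_spanning_trees_eq_card_rooted_choices[OF wf_digraph_axioms r])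
qed

corollary matrix_tree_rank_one_update:
  fixes u :: "nat \<Rightarrow> 'c :: idom"
  assumes G: "fin_digraph G" and bij: "bij_betw vs {0..<N} (verts G)" and N: "N > 0"
  shows "det (mat N N (\<lambda>(i, j). laplacian G (vs i) (vs j) + u i * u j)) =
    (\<Sum>i < N. u i)\<^sup>2 * of_nat (num_spanning_trees G)"
proof -
  have vs: "vs i \<in> verts G" if "i < N" for i using bij that by (auto simp: bij_betw_def)
  have rows: "(\<Sum>j < N. laplacian G (vs i) (vs j)) = (0 :: 'c)" if "i < N" for i
    using sum_laplacian_row[OF G vs[OF that]] sum.reindex_bij_betw[OF bij, of "laplacian G (vs i) :: _ \<Rightarrow> 'c"]
    by (simp add: atLeast0LessThan)
  have cols: "(\<Sum>i < N. laplacian G (vs i) (vs j)) = (0 :: 'c)" if "j < N" for j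
  proof -
    have "(\<Sum>i < N. laplacian G (vs i) (vs j)) = (\<Sum>i < N. laplacian G (vs j) (vs i) :: 'c)"
      by (intro sum.cong refl laplacian_sym[OF G])
    then show ?thesis using rows[OF that] by simp
  qed
  have eq: "vs i = vs 0 \<longleftrightarrow> i = 0" if "i < N" for i
    using bij that N by (auto simp: bij_betw_def inj_on_eq_iff)
  have "det (mat N N (\<lambda>(i, j). if i = 0 then of_bool (i = j) else laplacian G (vs i) (vs j))) =
      (of_nat (num_spanning_trees G) :: 'c)"
    unfolding matrix_tree[OF G vs[OF N] bij, symmetric]
    by (intro arg_cong[of _ _ det] cong_mat) (simp_all add: eq)
  then show ?thesis
    using det_rank_one_update_of_zero_sums[OF N rows cols, of u] by simp
qed

section \<open>Determinants of matrices with a known eigenbasis\<close>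

text \<open>
  A vector in the kernel of the transposed matrix is the coefficient vector of a polynomial of degree
  less than \<open>n\<close> that vanishes at the \<open>n\<close> distinct nodes.
\<close>

lemma det_vandermonde_neq_0:
  fixes x :: "nat \<Rightarrow> 'a :: idom"
  assumes "inj_on x {..<n}"
  shows "det (mat n n (\<lambda>(i, j). x j ^ i)) \<noteq> 0"
proof
  let ?V = "mat n n (\<lambda>(i, j). x i ^ j)"
  assume "det (mat n n (\<lambda>(i, j). x j ^ i)) = 0"
  moreover have "det (mat n n (\<lambda>(i, j). x j ^ i)) = det ?V"
    by (subst det_transpose[of _ n, symmetric]) (auto intro!: arg_cong[of _ _ det] eq_matI)
  ultimately obtain v where v: "v \<in> carrier_vec n" "v \<noteq> 0\<^sub>v n" "?V *\<^sub>v v = 0\<^sub>v n"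
    using det_0_iff_vec_prod_zero[of ?V n] by auto
  define p where "p = (\<Sum>j < n. monom (v $ j) j)"
  have coeff_p: "poly.coeff p j = v $ j" if "j < n" for j
    using that by (simp add: p_def coeff_sum if_distrib cong: if_cong)
  have "p = 0"
  proof (rule poly_eqI_degree)
    show "poly p z = poly 0 z" if "z \<in> x ` {..<n}" for z
    proof -
      obtain i where i: "i < n" "z = x i" using \<open>z \<in> x ` {..<n}\<close> by auto
      have "poly p z = (?V *\<^sub>v v) $ i"
        using i v(1) by (simp add: p_def poly_sum poly_monom scalar_prod_def atLeast0LessThan mult.commute)
      then show ?thesis using v(3) i(1) by simp
    qed
    have "n > 0" using v by (cases n) auto
    then show "degree (0 :: 'a poly) < card (x ` {..<n})" using assms by (simp add: card_image)
    have "degree p \<le> n - 1"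
      unfolding p_def by (intro degree_sum_le) (auto intro: order_trans[OF degree_monom_le])
    then show "degree p < card (x ` {..<n})" using assms \<open>n > 0\<close> by (simp add: card_image)
  qed
  then have "v = 0\<^sub>v n" using coeff_p v(1) by (intro eq_vecI) auto
  then show False using v(2) by simp
qed

lemma det_eq_prod_eigenvalues:
  fixes M V :: "nat \<Rightarrow> nat \<Rightarrow> 'a :: idom"
  assumes V: "det (mat n n (\<lambda>(i, j). V i j)) \<noteq> 0"
    and eigen: "\<And>i j. i < n \<Longrightarrow> j < n \<Longrightarrow> (\<Sum>k < n. M i k * V k j) = d j * V i j"
  shows "det (mat n n (\<lambda>(i, j). M i j)) = (\<Prod>j < n. d j)"
proof -
  let ?M = "mat n n (\<lambda>(i, j). M i j)" and ?V = "mat n n (\<lambda>(i, j). V i j)"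
  let ?D = "mat n n (\<lambda>(i, j). if i = j then d j else 0)"
  have "?M * ?V = ?V * ?D"
    by (rule eq_matI) (simp_all add: scalar_prod_def atLeast0LessThan eigen if_distrib cong: if_cong)
  moreover have "det (?M * ?V) = det ?M * det ?V" "det (?V * ?D) = det ?V * det ?D"
    by (rule det_mult[of _ n]; simp)+
  ultimately have "det ?M * det ?V = det ?V * det ?D" by metis
  moreover have "det ?D = (\<Prod>j < n. d j)"
  proof -
    have "det ?D = prod_list (diag_mat ?D)"
      by (rule det_upper_triangular[of _ n]) auto
    also have "\<dots> = (\<Prod>j < n. d j)"
      by (subst prod_list_diag_prod) (simp add: atLeast0LessThan)
    finally show ?thesis .
  qed
  ultimately show ?thesis using V by simp
qed

text \<open>
  Modulo the monic polynomial \<open>f\<close>, each \<open>p * x ^ k\<close> is an integer combination of \<open>1, x, \<dots>, x ^ (m - 1)\<close>.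
  The integer matrix of these coefficients has the vectors \<open>(1, x i, \<dots>, x i ^ (m - 1))\<close> as eigenvectors
  with the eigenvalues \<open>p (x i)\<close>, so the product of these values is its determinant.
\<close>

theorem prod_poly_at_roots_in_Ints:
  fixes f p :: "int poly" and x :: "nat \<Rightarrow> 'a :: {idom, ring_char_0}"
  assumes monic: "lead_coeff f = 1" and deg: "degree f = m"
    and inj: "inj_on x {..<m}"
    and roots: "\<And>i. i < m \<Longrightarrow> poly (of_int_poly f) (x i) = 0"
  shows "(\<Prod>i < m. poly (of_int_poly p) (x i)) \<in> \<int>"
proof -
  have f0: "f \<noteq> 0" using monic by auto
  define r where "r k = snd (pseudo_divmod (p * monom 1 k) f)" for k
  have r: "p * monom 1 k = f * fst (pseudo_divmod (p * monom 1 k) f) + r k"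
    "r k = 0 \<or> degree (r k) < m" for k
    using pseudo_divmod[OF f0, of "p * monom 1 k" "fst (pseudo_divmod (p * monom 1 k) f)" "r k"]
      monic deg by (simp_all add: r_def)
  have eval: "poly (of_int_poly p) (x i) * x i ^ k = (\<Sum>j < m. of_int (poly.coeff (r k) j) * x i ^ j)"
    if "i < m" for i k
  proof -
    have "poly (of_int_poly p) (x i) * x i ^ k = poly (of_int_poly (p * monom 1 k)) (x i)"
      by (simp add: of_int_poly_hom.hom_mult poly_monom)
    also have "\<dots> = poly (of_int_poly (r k)) (x i)"
      using roots[OF that] by (subst r(1)) (simp add: hom_distribs)
    also have "\<dots> = (\<Sum>j < m. of_int (poly.coeff (r k) j) * x i ^ j)"
    proof (cases "r k = 0")
      case False
      then have "degree (r k) < m" using r(2) by auto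
      then show ?thesis
        by (subst poly_altdef) (auto intro!: sum.mono_neutral_left intro: le_degree)
    qed simp
    finally show ?thesis .
  qed
  have "det (mat m m (\<lambda>(k, j). of_int (poly.coeff (r k) j) :: 'a)) = (\<Prod>i < m. poly (of_int_poly p) (x i))"
    by (rule det_eq_prod_eigenvalues[OF det_vandermonde_neq_0[OF inj]]) (simp add: eval)
  moreover have "mat m m (\<lambda>(k, j). of_int (poly.coeff (r k) j) :: 'a) =
      map_mat of_int (mat m m (\<lambda>(k, j). poly.coeff (r k) j))"
    by (rule eq_matI) auto
  ultimately have "(\<Prod>i < m. poly (of_int_poly p) (x i)) =
      of_int (det (mat m m (\<lambda>(k, j). poly.coeff (r k) j)))"
    by (simp add: of_int_hom.hom_det)
  then show ?thesis by simp
qed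

section \<open>Integer polynomials in \<open>2 cos t\<close>\<close>

text \<open>
  The Chebyshev polynomials of the second kind with shifted index and rescaled argument:
  \<open>sin (m t) / sin t\<close> as a polynomial in \<open>2 cos t\<close>. The rescaling makes them monic.
\<close>

fun sine_poly :: "nat \<Rightarrow> int poly" where
  "sine_poly 0 = 0"
| "sine_poly (Suc 0) = 1"
| "sine_poly (Suc (Suc m)) = [:0, 1:] * sine_poly (Suc m) - sine_poly m"

lemma sine_poly_eval: "sin t * poly (of_int_poly (sine_poly m)) (2 * cos t) = sin (real m * t)"
proof (induction m rule: sine_poly.induct)
  case (3 m)
  have "sin t * poly (of_int_poly (sine_poly (Suc (Suc m)))) (2 * cos t) =
      2 * cos t * (sin t * poly (of_int_poly (sine_poly (Suc m))) (2 * cos t)) -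
      sin t * poly (of_int_poly (sine_poly m)) (2 * cos t)"
    by (simp add: hom_distribs algebra_simps)
  also have "\<dots> = 2 * cos t * sin (real (Suc m) * t) - sin (real m * t)"
    by (simp only: 3)
  also have "\<dots> = sin (real (Suc (Suc m)) * t)"
  proof -
    have mid: "(real (Suc (Suc m)) * t + real m * t) / 2 = real (Suc m) * t"
      "(real (Suc (Suc m)) * t - real m * t) / 2 = t"
      by (simp_all add: field_simps)
    have "sin (real (Suc (Suc m)) * t) + sin (real m * t) = 2 * sin (real (Suc m) * t) * cos t"
      using sin_plus_sin[of "real (Suc (Suc m)) * t" "real m * t"] unfolding mid .
    then show ?thesis by (simp add: algebra_simps del: of_nat_Suc)
  qed
  finally show ?case .
qed simp_all

lemma sine_poly_monic: "degree (sine_poly (Suc m)) = m \<and> lead_coeff (sine_poly (Suc m)) = 1"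
proof (induction m rule: less_induct)
  case (less m)
  consider "m = 0" | "m = 1" | k where "m = Suc (Suc k)" by (metis One_nat_def not0_implies_Suc)
  then show ?case
  proof cases
    case 3
    define q where "q = sine_poly (Suc (Suc k))"
    have q: "degree q = Suc k" "lead_coeff q = 1" and deg: "degree (sine_poly (Suc k)) = k"
      using less[of "Suc k"] less[of k] 3 by (auto simp: q_def)
    then have "q \<noteq> 0" by auto
    then have p: "degree (pCons 0 q) = Suc (Suc k)" "lead_coeff (pCons 0 q) = 1"
      using q by simp_all
    have "sine_poly (Suc m) = - sine_poly (Suc k) + pCons 0 q" using 3 by (simp add: q_def)
    moreover have "degree (- sine_poly (Suc k)) < degree (pCons 0 q)" using deg p(1) by simp
    ultimately show ?thesis
      using p 3 degree_add_eq_right lead_coeff_add_le by metis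
  qed auto
qed

text \<open>
  The quotient \<open>(2 - 2 cos (m t)) / (2 - 2 cos t)\<close> as a polynomial in \<open>2 cos t\<close>. The numerator is the
  squared length of the chord of the unit circle that subtends the angle \<open>m t\<close>.
\<close>

fun chord_poly :: "nat \<Rightarrow> int poly" where
  "chord_poly 0 = 0"
| "chord_poly (Suc 0) = 1"
| "chord_poly (Suc (Suc m)) = [:0, 1:] * chord_poly (Suc m) - chord_poly m + 2"

lemma chord_poly_eval:
  "(2 - 2 * cos t) * poly (of_int_poly (chord_poly m)) (2 * cos t) = 2 - 2 * cos (real m * t)"
proof (induction m rule: chord_poly.induct)
  case (3 m)
  have "(2 - 2 * cos t) * poly (of_int_poly (chord_poly (Suc (Suc m)))) (2 * cos t) =
      2 * cos t * ((2 - 2 * cos t) * poly (of_int_poly (chord_poly (Suc m))) (2 * cos t)) -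
      (2 - 2 * cos t) * poly (of_int_poly (chord_poly m)) (2 * cos t) + 2 * (2 - 2 * cos t)"
    by (simp add: hom_distribs algebra_simps)
  also have "\<dots> = 2 * cos t * (2 - 2 * cos (real (Suc m) * t)) - (2 - 2 * cos (real m * t)) + 2 * (2 - 2 * cos t)"
    by (simp only: 3)
  also have "\<dots> = 2 - 2 * cos (real (Suc (Suc m)) * t)"
  proof -
    have mid: "(real (Suc (Suc m)) * t + real m * t) / 2 = real (Suc m) * t"
      "(real (Suc (Suc m)) * t - real m * t) / 2 = t"
      by (simp_all add: field_simps)
    have "cos (real (Suc (Suc m)) * t) + cos (real m * t) = 2 * cos (real (Suc m) * t) * cos t"
      using cos_plus_cos[of "real (Suc (Suc m)) * t" "real m * t"] unfolding mid .
    then show ?thesis by (simp add: algebra_simps del: of_nat_Suc)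
  qed
  finally show ?case .
qed simp_all

lemma chord_poly_at_minus_2: "poly (chord_poly m) (-2) = (if even m then 0 else 1)"
  by (induction m rule: chord_poly.induct) auto

text \<open>
  The numbers \<open>2 cos (2 \<pi> j / n)\<close> with \<open>0 < j < n / 2\<close> are distinct roots of a monic integer polynomial of
  matching degree \<open>m = (n - 1) div 2\<close>. Such a polynomial comes from \<open>sin ((m + 1) t)\<close> for \<open>n = 2 m + 2\<close>, and
  from \<open>sin ((m + 1) t) + sin (m t) = 2 sin (n t / 2) cos (t / 2)\<close> for \<open>n = 2 m + 1\<close>.
\<close>

lemma prod_poly_at_cosines_in_Ints:
  fixes p :: "int poly"
  assumes "n > 0"
  shows "(\<Prod>j < (n - 1) div 2. poly (of_int_poly p) (2 * cos (2 * pi * real (Suc j) / real n))) \<in> \<int>"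
proof -
  define m where "m = (n - 1) div 2"
  define f where "f = (if even n then sine_poly (Suc m) else sine_poly m + sine_poly (Suc m))"
  define t where "t j = 2 * pi * real (Suc j) / real n" for j
  have t: "0 < t j" "t j < pi" if "j < m" for j
  proof -
    have "2 * Suc j < n" using that assms unfolding m_def by presburger
    then have "real (2 * Suc j) < real n" by (simp only: of_nat_less_iff)
    then have "pi * real (2 * Suc j) < pi * real n" by (intro mult_strict_left_mono pi_gt_zero)
    then show "t j < pi" using assms by (simp add: t_def divide_less_eq mult_ac)
    show "0 < t j" using assms by (simp add: t_def)
  qed
  have f: "degree f = m \<and> lead_coeff f = 1"
  proof (cases "even n \<or> m = 0")
    case True
    then show ?thesis using sine_poly_monic[of m] by (auto simp: f_def)
  next
    case False
    then obtain k where k: "m = Suc k" by (cases m) auto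
    have "degree (sine_poly m) < degree (sine_poly (Suc m))"
      using sine_poly_monic[of m] sine_poly_monic[of k] k by simp
    moreover have "f = sine_poly m + sine_poly (Suc m)" using False by (simp add: f_def)
    ultimately show ?thesis
      using sine_poly_monic[of m] degree_add_eq_right lead_coeff_add_le by metis
  qed
  have "inj_on (\<lambda>j. 2 * cos (t j)) {..<m}"
  proof (rule inj_onI)
    fix i j assume ij: "i \<in> {..<m}" "j \<in> {..<m}" "2 * cos (t i) = 2 * cos (t j)"
    then have "t i = t j" using t[of i] t[of j] cos_inj_pi[of "t i" "t j"] by auto
    then show "i = j" using assms by (simp add: t_def)
  qed
  moreover have "poly (of_int_poly f) (2 * cos (t j)) = 0" if j: "j < m" for j
  proof -
    have s: "sin (t j) > 0" using t[OF j] by (intro sin_gt_zero) auto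
    have "sin (t j) * poly (of_int_poly f) (2 * cos (t j)) = 0"
    proof (cases "even n")
      case True
      then have "n = 2 * Suc m" using assms unfolding m_def by presburger
      then have "real n = 2 * real (Suc m)" by (simp only: of_nat_mult of_nat_numeral)
      then have "real (Suc m) * t j = pi * real (Suc j)"
        using assms by (simp add: t_def field_simps)
      then show ?thesis
        using True sine_poly_eval[of "t j" "Suc m"] sin_npi2[of "Suc j"] by (simp add: f_def)
    next
      case False
      then have "n = 2 * m + 1" using assms unfolding m_def by presburger
      then have n: "real n = 2 * real m + 1" by simp
      have "sin (t j) * poly (of_int_poly f) (2 * cos (t j)) = sin (real (Suc m) * t j) + sin (real m * t j)"
        using False sine_poly_eval[of "t j" "Suc m"] sine_poly_eval[of "t j" m]
        by (simp add: f_def hom_distribs algebra_simps)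
      also have "\<dots> = 2 * sin ((2 * real m + 1) * t j / 2) * cos (t j / 2)"
        by (subst sin_plus_sin) (simp add: algebra_simps)
      also have "(2 * real m + 1) * t j / 2 = pi * real (Suc j)"
        using assms unfolding n[symmetric] by (simp add: t_def)
      also have "sin \<dots> = 0" by (rule sin_npi2)
      finally show ?thesis by simp
    qed
    then show ?thesis using s by simp
  qed
  ultimately have "(\<Prod>j < m. poly (of_int_poly p) (2 * cos (t j))) \<in> \<int>"
    using prod_poly_at_roots_in_Ints[of f m "\<lambda>j. 2 * cos (t j)" p] f by blast
  then show ?thesis by (simp only: m_def t_def)
qed

section \<open>Products over the residues modulo \<open>n\<close>\<close>

lemma prod_reflection_symmetric:
  fixes g :: "nat \<Rightarrow> 'a :: comm_monoid_mult"
  assumes "n > 0" and sym: "\<And>j. 0 < j \<Longrightarrow> j < n \<Longrightarrow> g (n - j) = g j"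
  shows "(\<Prod>j = 1..<n. g j) =
    (\<Prod>j < (n - 1) div 2. g (Suc j)) ^ 2 * (if even n then g (n div 2) else 1)"
proof -
  define m where "m = (n - 1) div 2"
  let ?lo = "{1..m}" and ?hi = "{n - m..<n}" and ?mid = "if even n then {n div 2} else {}"
  have m: "2 * m < n" using assms(1) by (auto simp: m_def)
  have split: "{1..<n} = ?lo \<union> ?hi \<union> ?mid"
    using assms(1) unfolding m_def by (cases "even n") (auto elim!: evenE oddE)
  have lo: "prod g ?lo = (\<Prod>j < m. g (Suc j))"
    by (rule prod.reindex_bij_witness[of _ Suc "\<lambda>j. j - 1"]) auto
  have "prod g ?hi = (\<Prod>j < m. g (n - Suc j))"
    by (rule prod.reindex_bij_witness[of _ "\<lambda>j. n - Suc j" "\<lambda>j. n - Suc j"]) (use m in auto)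
  also have "\<dots> = (\<Prod>j < m. g (Suc j))"
    using m by (intro prod.cong refl sym) auto
  finally have hi: "prod g ?hi = (\<Prod>j < m. g (Suc j))" .
  have "prod g {1..<n} = prod g ?lo * prod g ?hi * prod g ?mid"
    unfolding split using m assms(1)
    by (subst prod.union_disjoint; (subst prod.union_disjoint)?) (auto simp: m_def elim!: evenE)
  then show ?thesis
    unfolding m_def[symmetric] by (simp add: lo hi power2_eq_square del: One_nat_def)
qed

text \<open>
  The factors are the squared distances from \<open>1\<close> to the other \<open>n\<close>-th roots of unity \<open>w j\<close>. Evaluating
  \<open>(\<Prod>j = 1..<n. z - w j) = 1 + z + \<dots> + z ^ (n - 1)\<close> at \<open>z = 1\<close> shows that the product of the distances is \<open>n\<close>.
\<close>

lemma prod_chord_lengths: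
  assumes "n > 0"
  shows "(\<Prod>j = 1..<n. 2 - 2 * cos (2 * pi * real j / real n)) = (real n)\<^sup>2"
proof -
  define w where "w j = cis (2 * pi * real j / real n)" for j
  define p where "p = (\<Sum>i < n. monom (1 :: complex) i)"
  define q where "q = (\<Prod>j = 1..<n. [:- w j, 1:])"
  have inj: "inj_on w {..<n}"
    using bij_betw_roots_unity[OF assms] by (simp add: bij_betw_def w_def[abs_def])
  have deg_q: "degree q = n - 1" unfolding q_def by (subst degree_prod_eq_sum_degree) auto
  have "p = q"
  proof (rule poly_eqI_degree_lead_coeff)
    show "poly.coeff p (n - 1) = poly.coeff q (n - 1)"
    proof -
      have "poly.coeff q (n - 1) = lead_coeff q" by (simp add: deg_q)
      also have "\<dots> = 1" unfolding q_def by (simp add: lead_coeff_prod)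
      finally show ?thesis using assms by (simp add: p_def coeff_sum)
    qed
    show "card (w ` {1..<n}) \<ge> n - 1"
      using inj by (subst card_image) (auto intro: inj_on_subset)
    show "degree p \<le> n - 1"
      unfolding p_def by (intro degree_sum_le) (auto intro: order_trans[OF degree_monom_le])
    show "degree q \<le> n - 1" by (simp add: deg_q)
    show "poly p z = poly q z" if "z \<in> w ` {1..<n}" for z
    proof -
      obtain j where j: "1 \<le> j" "j < n" "z = w j" using \<open>z \<in> w ` {1..<n}\<close> by auto
      have "w j \<noteq> w 0" using inj_onD[OF inj, of j 0] j by auto
      then have "z \<noteq> 1" using j by (simp add: w_def)
      moreover have "z ^ n = 1" using j assms by (simp add: w_def DeMoivre)
      ultimately have "poly p z = 0"
        using geometric_sum[of z n] by (simp add: p_def poly_sum poly_monom)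
      moreover have "poly q z = 0" using j by (auto simp: q_def poly_prod)
      ultimately show ?thesis by simp
    qed
  qed
  have "poly p 1 = of_nat n" by (simp add: p_def poly_sum poly_monom)
  moreover have "poly q 1 = (\<Prod>j = 1..<n. 1 - w j)" by (simp add: q_def poly_prod)
  ultimately have "(\<Prod>j = 1..<n. 1 - w j) = of_nat n" using \<open>p = q\<close> by simp
  then have "(\<Prod>j = 1..<n. (cmod (1 - w j))\<^sup>2) = (real n)\<^sup>2"
    by (simp only: prod_power_distrib[symmetric] prod_norm norm_of_nat)
  moreover have "(cmod (1 - w j))\<^sup>2 = 2 - 2 * cos (2 * pi * real j / real n)" for j
  proof -
    have "(1 - cos t)\<^sup>2 + (sin t)\<^sup>2 = 2 - 2 * cos t" for t :: real
      using sin_cos_squared_add[of t] by (simp add: power2_eq_square algebra_simps)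
    then show ?thesis by (simp add: cmod_power2 w_def)
  qed
  ultimately show ?thesis by simp
qed

section \<open>The Laplacian of an I-graph\<close>

text \<open>
  The residue of \<open>i - d\<close>, written without truncated subtraction.
\<close>

definition pred_mod :: "nat \<Rightarrow> nat \<Rightarrow> nat \<Rightarrow> nat" where
  "pred_mod n d i = (i + (n - d mod n)) mod n"

lemma add_complement_mod:
  fixes n d :: nat
  assumes "n > 0"
  shows "d + (n - d mod n) = n * (d div n) + n"
proof -
  have "d mod n \<le> n" using assms by (simp add: less_imp_le)
  then show ?thesis using mult_div_mod_eq[of n d] by linarith
qed

lemma add_mod_eq_iff_pred_mod:
  assumes "s < n" "i < n"
  shows "(s + d) mod n = i \<longleftrightarrow> s = pred_mod n d i"
proof -
  have d: "d + (n - d mod n) = n * (d div n) + n" using assms by (intro add_complement_mod) simp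
  have "((s + d) mod n + (n - d mod n)) mod n = s"
  proof -
    have "((s + d) mod n + (n - d mod n)) mod n = (s + (d + (n - d mod n))) mod n"
      by (simp add: mod_simps add.assoc)
    then show ?thesis using assms unfolding d by (simp flip: add.assoc)
  qed
  moreover have "((i + (n - d mod n)) mod n + d) mod n = i"
  proof -
    have "((i + (n - d mod n)) mod n + d) mod n = (i + (d + (n - d mod n))) mod n"
      by (simp add: mod_simps ac_simps)
    then show ?thesis using assms unfolding d by (simp flip: add.assoc)
  qed
  ultimately show ?thesis unfolding pred_mod_def by metis
qed

lemma pred_mod_less: "n > 0 \<Longrightarrow> pred_mod n d i < n"
  by (simp add: pred_mod_def)

lemma pred_mod_neq:
  assumes "i < n" "\<not> n dvd d"
  shows "pred_mod n d i \<noteq> i"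
proof
  assume "pred_mod n d i = i"
  then have "(i + d) mod n = i mod n" using add_mod_eq_iff_pred_mod[of i n i d] assms by simp
  then have "n dvd (i + d) - i" using mod_eq_dvd_iff_nat[of i "i + d" n] by simp
  then show False using assms by simp
qed

text \<open>
  The matrix \<open>3 - T\<^sup>d - T\<^sup>-\<^sup>d\<close>, where \<open>T\<close> is the cyclic shift of the residues modulo \<open>n\<close>.
\<close>

definition circulant_block :: "nat \<Rightarrow> nat \<Rightarrow> nat \<Rightarrow> nat \<Rightarrow> 'c :: comm_ring_1" where
  "circulant_block n d i j =
     3 * of_bool (i = j) - of_bool ((i + d) mod n = j) - of_bool (pred_mod n d i = j)"

text \<open>
  The three edges of each set are distinct when \<open>n\<close> does not divide \<open>l\<close> or \<open>k\<close>, respectively; the two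
  outer (or inner) edges may still be parallel.
\<close>

lemma incident_I_graph:
  assumes "i < n"
  shows "incident (I_graph n k l) (Uvert i) = {Spoke i, Uedge i, Uedge (pred_mod n l i)}"
    and "incident (I_graph n k l) (Vvert i) = {Spoke i, Vedge i, Vedge (pred_mod n k i)}"
proof -
  have pred: "s < n \<and> (s + d) mod n = i \<longleftrightarrow> s = pred_mod n d i" for s d
    using add_mod_eq_iff_pred_mod[OF _ assms] pred_mod_less[of n d i] assms by auto
  have "e \<in> incident (I_graph n k l) (Uvert i) \<longleftrightarrow> e \<in> {Spoke i, Uedge i, Uedge (pred_mod n l i)}" for e
  proof (cases e)
    case (Uedge s)
    have "e \<in> incident (I_graph n k l) (Uvert i) \<longleftrightarrow> s < n \<and> (s = i \<or> (s + l) mod n = i)"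
      unfolding Uedge by (simp add: incident_def I_graph_def image_iff)
    also have "\<dots> \<longleftrightarrow> s = i \<or> s = pred_mod n l i" using pred[of s l] assms by blast
    finally show ?thesis unfolding Uedge by simp
  qed (use assms in \<open>auto simp: incident_def I_graph_def\<close>)
  then show "incident (I_graph n k l) (Uvert i) = {Spoke i, Uedge i, Uedge (pred_mod n l i)}" by blast
  have "e \<in> incident (I_graph n k l) (Vvert i) \<longleftrightarrow> e \<in> {Spoke i, Vedge i, Vedge (pred_mod n k i)}" for e
  proof (cases e)
    case (Vedge s)
    have "e \<in> incident (I_graph n k l) (Vvert i) \<longleftrightarrow> s < n \<and> (s = i \<or> (s + k) mod n = i)"
      unfolding Vedge by (simp add: incident_def I_graph_def image_iff)
    also have "\<dots> \<longleftrightarrow> s = i \<or> s = pred_mod n k i" using pred[of s k] assms by blast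
    finally show ?thesis unfolding Vedge by simp
  qed (use assms in \<open>auto simp: incident_def I_graph_def\<close>)
  then show "incident (I_graph n k l) (Vvert i) = {Spoke i, Vedge i, Vedge (pred_mod n k i)}" by blast
qed

lemma opposite_I_graph:
  "opposite (I_graph n k l) (Spoke i) (Uvert i) = Vvert i"
  "opposite (I_graph n k l) (Spoke i) (Vvert i) = Uvert i"
  "opposite (I_graph n k l) (Uedge i) (Uvert i) = Uvert ((i + l) mod n)"
  "opposite (I_graph n k l) (Vedge i) (Vvert i) = Vvert ((i + k) mod n)"
  "s \<noteq> i \<Longrightarrow> opposite (I_graph n k l) (Uedge s) (Uvert i) = Uvert s"
  "s \<noteq> i \<Longrightarrow> opposite (I_graph n k l) (Vedge s) (Vvert i) = Vvert s"
  by (simp_all add: opposite_def I_graph_def)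

lemma laplacian_I_graph:
  assumes "i < n" "j < n" "\<not> n dvd k" "\<not> n dvd l"
  shows "laplacian (I_graph n k l) (Uvert i) (Uvert j) = circulant_block n l i j"
    and "laplacian (I_graph n k l) (Uvert i) (Vvert j) = - of_bool (i = j)"
    and "laplacian (I_graph n k l) (Vvert i) (Uvert j) = - of_bool (i = j)"
    and "laplacian (I_graph n k l) (Vvert i) (Vvert j) = circulant_block n k i j"
proof -
  have neq: "pred_mod n k i \<noteq> i" "i \<noteq> pred_mod n k i" "pred_mod n l i \<noteq> i" "i \<noteq> pred_mod n l i"
    using pred_mod_neq[OF assms(1)] assms(3,4) by metis+
  note defs = laplacian_def incident_I_graph[OF assms(1)] opposite_I_graph neq circulant_block_def
  show "laplacian (I_graph n k l) (Uvert i) (Uvert j) = circulant_block n l i j"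
    "laplacian (I_graph n k l) (Uvert i) (Vvert j) = - of_bool (i = j)"
    "laplacian (I_graph n k l) (Vvert i) (Uvert j) = - of_bool (i = j)"
    "laplacian (I_graph n k l) (Vvert i) (Vvert j) = circulant_block n k i j"
    by (simp_all add: defs)
qed

definition I_vertex_at :: "nat \<Rightarrow> nat \<Rightarrow> I_vertex" where
  "I_vertex_at n i = (if i < n then Uvert i else Vvert (i - n))"

lemma bij_betw_I_vertex_at: "bij_betw (I_vertex_at n) {0..<n + n} (verts (I_graph n k l))"
proof (rule bij_betwI')
  show "\<exists>i \<in> {0..<n + n}. v = I_vertex_at n i" if v: "v \<in> verts (I_graph n k l)" for v
  proof -
    consider i where "i < n" "v = Uvert i" | i where "i < n" "v = Vvert i"
      using v by (auto simp: I_graph_def)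
    then show ?thesis
    proof cases
      case (1 i) then show ?thesis by (intro bexI[of _ i]) (auto simp: I_vertex_at_def)
    next
      case (2 i) then show ?thesis by (intro bexI[of _ "n + i"]) (auto simp: I_vertex_at_def)
    qed
  qed
next
  show "I_vertex_at n i = I_vertex_at n j \<longleftrightarrow> i = j" for i j
    unfolding I_vertex_at_def by (cases "i < n"; cases "j < n") auto
  show "I_vertex_at n i \<in> verts (I_graph n k l)" if "i \<in> {0..<n + n}" for i
    using that by (cases "i < n") (simp_all add: I_vertex_at_def I_graph_def)
qed

text \<open>
  The powers of an \<open>n\<close>-th root of unity form an eigenvector of the circulant block.
\<close>

lemma sum_circulant_block:
  fixes z :: "'c :: comm_ring_1"
  assumes "i < n" "z ^ n = 1"
  shows "(\<Sum>j < n. circulant_block n d i j * z ^ j) = (3 - z ^ d - z ^ (n - d mod n)) * z ^ i"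
proof -
  have pick: "(\<Sum>j < n. of_bool (c = j) * z ^ j) = z ^ c" if "c < n" for c
    using sum.delta'[of "{..<n}" c "\<lambda>j. z ^ j"] that
    by (simp add: of_bool_def if_distrib[of "\<lambda>t. t * _"] cong: if_cong)
  have mod: "z ^ (m mod n) = z ^ m" for m
  proof -
    have "z ^ m = z ^ (n * (m div n) + m mod n)" by simp
    also have "\<dots> = z ^ (m mod n)" unfolding power_add power_mult assms(2) by simp
    finally show ?thesis by simp
  qed
  have "(\<Sum>j < n. circulant_block n d i j * z ^ j) =
      3 * (\<Sum>j < n. of_bool (i = j) * z ^ j) - (\<Sum>j < n. of_bool ((i + d) mod n = j) * z ^ j) -
      (\<Sum>j < n. of_bool (pred_mod n d i = j) * z ^ j)"
    unfolding circulant_block_def sum_distrib_left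
    by (simp add: left_diff_distrib sum_subtractf mult.assoc)
  also have "\<dots> = 3 * z ^ i - z ^ (i + d) - z ^ (i + (n - d mod n))"
    using assms(1) pred_mod_less[of n d i] by (simp add: pick mod) (simp add: pred_mod_def mod)
  also have "\<dots> = (3 - z ^ d - z ^ (n - d mod n)) * z ^ i"
    by (simp add: power_add algebra_simps)
  finally show ?thesis .
qed

lemma cis_power_add_inverse_power:
  assumes "cis t ^ n = 1" "n > 0"
  shows "cis t ^ d + cis t ^ (n - d mod n) = of_real (2 * cos (real d * t))"
proof -
  have "cis t ^ d * cis t ^ (n - d mod n) = cis t ^ (n * (d div n) + n)"
    unfolding add_complement_mod[OF assms(2), symmetric] by (rule power_add[symmetric])
  also have "\<dots> = 1" unfolding power_add power_mult assms(1) by simp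
  finally have "cis (real d * t) * cis t ^ (n - d mod n) = 1" by (simp add: DeMoivre)
  then have "cis (- (real d * t)) * (cis (real d * t) * cis t ^ (n - d mod n)) = cis (- (real d * t))"
    by simp
  then have "cis t ^ (n - d mod n) = cis (- (real d * t))"
    by (simp add: cis_mult flip: mult.assoc)
  then show ?thesis by (simp add: DeMoivre complex_eq_iff)
qed

text \<open>
  The update by the indicator vector of the \<open>u\<close>-vertices adds the all-ones matrix to the upper left
  block, so all four blocks stay circulant. As the lower left block is \<open>- 1\<close>, the \<open>2 n \<times> 2 n\<close>
  determinant collapses to the determinant of \<open>A D - 1\<close>.
\<close>

lemma det_updated_laplacian:
  assumes "\<not> n dvd k" "\<not> n dvd l"
  shows "det (mat (n + n) (n + n) (\<lambda>(i, j).
        laplacian (I_graph n k l) (I_vertex_at n i) (I_vertex_at n j) + of_bool (i < n) * of_bool (j < n)))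
    = det (mat n n (\<lambda>(i, j).
        (\<Sum>s < n. (circulant_block n l i s + 1) * circulant_block n k s j) - of_bool (i = j)) :: 'c :: idom mat)"
proof -
  let ?A = "mat n n (\<lambda>(i, j). circulant_block n l i j + 1) :: 'c mat"
  let ?D = "mat n n (\<lambda>(i, j). circulant_block n k i j) :: 'c mat"
  have "mat (n + n) (n + n) (\<lambda>(i, j).
        laplacian (I_graph n k l) (I_vertex_at n i) (I_vertex_at n j) + of_bool (i < n) * of_bool (j < n))
      = four_block_mat ?A (- 1\<^sub>m n) (- 1\<^sub>m n) ?D"
    by (intro eq_matI) (auto simp: I_vertex_at_def laplacian_I_graph[OF _ _ assms])
  moreover have "det (four_block_mat ?A (- 1\<^sub>m n) (- 1\<^sub>m n) ?D) = det (?A * ?D - (- 1\<^sub>m n) * (- 1\<^sub>m n))"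
    by (rule det_four_block_mat[of _ n]) auto
  moreover have "?A * ?D - (- 1\<^sub>m n) * (- 1\<^sub>m n) = mat n n (\<lambda>(i, j).
        (\<Sum>s < n. (circulant_block n l i s + 1) * circulant_block n k s j) - of_bool (i = j))"
    by (rule eq_matI) (auto simp: scalar_prod_def atLeast0LessThan)
  ultimately show ?thesis by simp
qed

text \<open>
  The updated Laplacian has determinant \<open>n\<^sup>2 \<tau>\<close>, and the Fourier basis diagonalises the \<open>n \<times> n\<close> matrix to
  which it was reduced. The all-ones matrix only acts on the constant vector: it turns the eigenvalue for \<open>j = 0\<close>,
  which would be \<open>0\<close>, into \<open>n\<close>.
\<close>

theorem num_spanning_trees_I_graph_eigenvalues:
  assumes n: "n > 0" and nk: "\<not> n dvd k" and nl: "\<not> n dvd l"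
  shows "real n * real (num_spanning_trees (I_graph n k l)) =
    (\<Prod>j = 1..<n. (3 - 2 * cos (real l * (2 * pi * real j / real n))) *
                  (3 - 2 * cos (real k * (2 * pi * real j / real n))) - 1)"
proof -
  define t where "t j = 2 * pi * real j / real n" for j
  define z where "z j = cis (t j)" for j
  define \<alpha> where "\<alpha> d j = 3 - 2 * cos (real d * t j)" for d j
  \<comment> \<open>\<open>b j\<close> is the eigenvalue of the all-ones matrix at the \<open>j\<close>-th Fourier vector.\<close>
  define b where "b j = (if j = 0 then real n else 0)" for j :: nat
  let ?\<tau> = "num_spanning_trees (I_graph n k l)"
  let ?M = "\<lambda>i j. (\<Sum>s < n. (circulant_block n l i s + 1) * circulant_block n k s j) - of_bool (i = j) :: complex"
  have zn: "z j ^ n = 1" for j using n by (simp add: z_def t_def DeMoivre)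
  have inj: "inj_on z {..<n}"
    using bij_betw_roots_unity[OF n] by (simp add: bij_betw_def z_def[abs_def] t_def)
  have z1: "z j \<noteq> 1" if "0 < j" "j < n" for j
    using inj_onD[OF inj, of j 0] that by (auto simp: z_def t_def)
  have circ: "(\<Sum>s < n. circulant_block n d i s * z j ^ s) = of_real (\<alpha> d j) * z j ^ i" if "i < n" for d i j
  proof -
    have "z j ^ d + z j ^ (n - d mod n) = of_real (2 * cos (real d * t j))"
      using cis_power_add_inverse_power[of "t j" n d] zn[of j] n by (simp add: z_def)
    then have "3 - z j ^ d - z j ^ (n - d mod n) = of_real (\<alpha> d j)"
      by (simp add: diff_diff_eq \<alpha>_def)
    then show ?thesis using sum_circulant_block[OF that zn[of j], of d] by simp
  qed
  have ones: "(\<Sum>s < n. z j ^ s) = of_real (b j) * z j ^ i" if "j < n" for i j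
  proof (cases "j = 0")
    case True
    then show ?thesis by (simp add: b_def z_def t_def)
  next
    case False
    then show ?thesis using geometric_sum[of "z j" n] z1[of j] zn[of j] that by (simp add: b_def)
  qed
  have eigen: "(\<Sum>c < n. ?M i c * z j ^ c) = of_real ((\<alpha> l j + b j) * \<alpha> k j - 1) * z j ^ i"
    if ij: "i < n" "j < n" for i j
  proof -
    have "(\<Sum>c < n. ?M i c * z j ^ c) =
        (\<Sum>c < n. \<Sum>s < n. (circulant_block n l i s + 1) * (circulant_block n k s c * z j ^ c)) -
        (\<Sum>c < n. of_bool (i = c) * z j ^ c)"
      by (simp add: left_diff_distrib sum_subtractf sum_distrib_right mult.assoc)
    also have "(\<Sum>c < n. of_bool (i = c) * z j ^ c) = z j ^ i"
      using sum.delta'[of "{..<n}" i "\<lambda>c. z j ^ c"] ij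
      by (simp add: of_bool_def if_distrib[of "\<lambda>t. t * _"] cong: if_cong)
    also have "(\<Sum>c < n. \<Sum>s < n. (circulant_block n l i s + 1) * (circulant_block n k s c * z j ^ c)) =
        (\<Sum>s < n. (circulant_block n l i s + 1) * (\<Sum>c < n. circulant_block n k s c * z j ^ c))"
      by (subst sum.swap) (simp add: sum_distrib_left)
    also have "\<dots> = (\<Sum>s < n. (circulant_block n l i s + 1) * (of_real (\<alpha> k j) * z j ^ s))"
      by (intro sum.cong refl) (simp add: circ)
    also have "\<dots> = of_real (\<alpha> k j) * ((\<Sum>s < n. circulant_block n l i s * z j ^ s) + (\<Sum>s < n. z j ^ s))"
      by (simp add: sum_distrib_left sum.distrib algebra_simps)
    also have "\<dots> = of_real (\<alpha> k j) * (of_real (\<alpha> l j) * z j ^ i + of_real (b j) * z j ^ i)"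
      using circ[OF ij(1)] ones[OF ij(2), of i] by simp
    finally show ?thesis by (simp add: algebra_simps)
  qed
  have "(of_nat n)\<^sup>2 * of_nat ?\<tau> = (\<Sum>i < n + n. of_bool (i < n) :: complex)\<^sup>2 * of_nat ?\<tau>"
  proof -
    have "(\<Sum>i < n + n. of_bool (i < n) :: complex) = of_nat (card ({..<n + n} \<inter> {i. i < n}))"
      by simp
    also have "{..<n + n} \<inter> {i. i < n} = {..<n}" by auto
    finally show ?thesis by simp
  qed
  also have "\<dots> = det (mat (n + n) (n + n) (\<lambda>(i, j).
        laplacian (I_graph n k l) (I_vertex_at n i) (I_vertex_at n j) + of_bool (i < n) * of_bool (j < n)))"
    using n by (intro matrix_tree_rank_one_update[OF fin_digraph_I_graph bij_betw_I_vertex_at, symmetric]) simp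
  also have "\<dots> = det (mat n n (\<lambda>(i, j). ?M i j))" by (rule det_updated_laplacian[OF nk nl])
  also have "\<dots> = (\<Prod>j < n. of_real ((\<alpha> l j + b j) * \<alpha> k j - 1))"
    by (rule det_eq_prod_eigenvalues[OF det_vandermonde_neq_0[OF inj] eigen])
  finally have "of_real ((real n)\<^sup>2 * real ?\<tau>) = (of_real (\<Prod>j < n. (\<alpha> l j + b j) * \<alpha> k j - 1) :: complex)"
    by simp
  then have "(real n)\<^sup>2 * real ?\<tau> = (\<Prod>j < n. (\<alpha> l j + b j) * \<alpha> k j - 1)"
    by (simp only: of_real_eq_iff)
  also have "\<dots> = ((\<alpha> l 0 + b 0) * \<alpha> k 0 - 1) * (\<Prod>j = 1..<n. (\<alpha> l j + b j) * \<alpha> k j - 1)"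
    using n by (simp add: prod.atLeast_Suc_lessThan flip: atLeast0LessThan)
  also have "(\<alpha> l 0 + b 0) * \<alpha> k 0 - 1 = real n" by (simp add: \<alpha>_def b_def t_def)
  also have "(\<Prod>j = 1..<n. (\<alpha> l j + b j) * \<alpha> k j - 1) = (\<Prod>j = 1..<n. \<alpha> l j * \<alpha> k j - 1)"
    by (intro prod.cong) (auto simp: b_def)
  finally have "real n * (real n * real ?\<tau>) = real n * (\<Prod>j = 1..<n. \<alpha> l j * \<alpha> k j - 1)"
    by (simp add: power2_eq_square mult.assoc)
  then show ?thesis using n by (simp add: \<alpha>_def t_def)
qed

section \<open>Spanning trees of I-graphs\<close>

text \<open>
  Expanding \<open>(1 + c F\<^sub>l) (1 + c F\<^sub>k) - 1\<close> for \<open>c = 2 - 2 cos t\<close> and dividing by \<open>c\<close> leaves this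
  polynomial in \<open>2 cos t\<close>.
\<close>

definition I_graph_poly :: "nat \<Rightarrow> nat \<Rightarrow> int poly" where
  "I_graph_poly k l = chord_poly l + chord_poly k + [:2, -1:] * chord_poly l * chord_poly k"

lemma I_graph_poly_eval:
  "(3 - 2 * cos (real l * t)) * (3 - 2 * cos (real k * t)) - 1 =
    (2 - 2 * cos t) * poly (of_int_poly (I_graph_poly k l)) (2 * cos t)"
proof -
  let ?F = "\<lambda>m. poly (of_int_poly (chord_poly m)) (2 * cos t)"
  have chord: "3 - 2 * cos (real m * t) = 1 + (2 - 2 * cos t) * ?F m" for m
    using chord_poly_eval[of t m] by linarith
  have "poly (of_int_poly (I_graph_poly k l)) (2 * cos t) = ?F l + ?F k + (2 - 2 * cos t) * ?F l * ?F k"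
    by (simp add: I_graph_poly_def of_int_poly_hom.hom_add of_int_poly_hom.hom_mult del: mult_pCons_left)
  moreover have "(1 + c * x) * (1 + c * y) - 1 = c * (x + y + c * x * y)" for c x y :: real
    by (simp add: algebra_simps)
  ultimately show ?thesis by (simp only: chord)
qed

lemma num_spanning_trees_I_graph:
  assumes n: "n > 0" and "\<not> n dvd k" "\<not> n dvd l"
  shows "real (num_spanning_trees (I_graph n k l)) =
    real n * (\<Prod>j = 1..<n. poly (of_int_poly (I_graph_poly k l)) (2 * cos (2 * pi * real j / real n)))"
proof -
  let ?S = "\<Prod>j = 1..<n. poly (of_int_poly (I_graph_poly k l)) (2 * cos (2 * pi * real j / real n))"
  have "real n * real (num_spanning_trees (I_graph n k l)) =
      (\<Prod>j = 1..<n. 2 - 2 * cos (2 * pi * real j / real n)) * ?S"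
    unfolding num_spanning_trees_I_graph_eigenvalues[OF assms] I_graph_poly_eval prod.distrib ..
  also have "\<dots> = real n * (real n * ?S)"
    unfolding prod_chord_lengths[OF n] by (simp only: power2_eq_square mult.assoc)
  finally show ?thesis using n by simp
qed

text \<open>
  The factors for \<open>j\<close> and \<open>n - j\<close> agree, and for even \<open>n\<close> the unpaired factor \<open>j = n div 2\<close> is the value at
  \<open>2 cos \<pi> = -2\<close>.
\<close>

lemma num_spanning_trees_I_graph_square:
  assumes n: "n > 0" and "\<not> n dvd k" "\<not> n dvd l"
  shows "\<exists>a. int (num_spanning_trees (I_graph n k l)) =
    int n * a\<^sup>2 * (if even n then poly (I_graph_poly k l) (-2) else 1)"
proof -
  let ?p = "I_graph_poly k l"
  define g where "g j = poly (of_int_poly ?p) (2 * cos (2 * pi * real j / real n))" for j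
  have sym: "g (n - j) = g j" if "0 < j" "j < n" for j
  proof -
    have "2 * pi * real (n - j) / real n = 2 * pi - 2 * pi * real j / real n"
      using that by (simp add: field_simps of_nat_diff)
    then show ?thesis by (simp add: g_def)
  qed
  have mid: "g (n div 2) = of_int (poly ?p (-2))" if "even n"
  proof -
    have "2 * pi * real (n div 2) / real n = pi" using that n by (auto elim!: evenE)
    then have "g (n div 2) = poly (of_int_poly ?p) (of_int (-2))" by (simp add: g_def)
    then show ?thesis by (simp only: of_int_hom.poly_map_poly)
  qed
  obtain a where a: "(\<Prod>j < (n - 1) div 2. g (Suc j)) = of_int a"
    using prod_poly_at_cosines_in_Ints[OF n, of ?p] by (auto simp: g_def elim!: Ints_cases)
  have "real (num_spanning_trees (I_graph n k l)) =
      real n * ((of_int a)\<^sup>2 * (if even n then g (n div 2) else 1))"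
    using num_spanning_trees_I_graph[OF assms] prod_reflection_symmetric[of n g, OF n sym] a
    by (simp add: g_def)
  also have "\<dots> = of_int (int n * a\<^sup>2 * (if even n then poly ?p (-2) else 1))"
    using mid by simp
  finally show ?thesis by (metis of_int_eq_iff of_int_of_nat_eq)
qed

theorem theorem5p5:
  fixes k l :: nat
  assumes "k > 0" and "l > 0" and "gcd k l = 1"
  shows "\<exists>a :: nat \<Rightarrow> int. \<forall>n :: nat. n > 0 \<longrightarrow> \<not> n dvd k \<longrightarrow> \<not> n dvd l \<longrightarrow>
    (odd n \<longrightarrow>
       int (num_spanning_trees (I_graph n k l)) = int n * (a n)^2) \<and>
    (even n \<and> even (k + l) \<longrightarrow>
       int (num_spanning_trees (I_graph n k l)) = 6 * int n * (a n)^2) \<and>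
    (even n \<and> odd (k + l) \<longrightarrow>
       int (num_spanning_trees (I_graph n k l)) = int n * (a n)^2)"
proof -
  have not_both_even: "\<not> (even k \<and> even l)"
  proof
    assume "even k \<and> even l"
    then have "2 dvd gcd k l" by simp
    then show False using assms(3) by simp
  qed
  have at_minus_2: "poly (I_graph_poly k l) (-2) = (if even (k + l) then 6 else 1)"
    using not_both_even by (auto simp: I_graph_poly_def chord_poly_at_minus_2)
  define a where "a n = (SOME a. int (num_spanning_trees (I_graph n k l)) =
    int n * a\<^sup>2 * (if even n then poly (I_graph_poly k l) (-2) else 1))" for n
  have "int (num_spanning_trees (I_graph n k l)) =
      int n * (a n)\<^sup>2 * (if even n then poly (I_graph_poly k l) (-2) else 1)"
    if "n > 0" "\<not> n dvd k" "\<not> n dvd l" for n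
    unfolding a_def by (rule someI_ex[OF num_spanning_trees_I_graph_square[OF that]])
  then show ?thesis unfolding at_minus_2 by (intro exI[of _ a]) auto
qed

end
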